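(* Let $A$ be a real skew-symmetric $N\times N$ matrix and $B$ a real $N\times r$ matrix such that the pair $(A,B)$ is controllable, and let $K_{(A,B)}$ be the minimal non-negative integer such that $\operatorname{rank}[B,AB,\dots,A^{K_{(A,B)}}B]=N$. Let $\rho>0$ and let $\alpha\in L^\infty([0,\infty),[0,1])$ be such that there exists a sequence $(a_n,b_n)$, $n\in\mathbb{N}$, of pairwise disjoint intervals in $[0,\infty)$ with $\int_{a_n}^{b_n}\alpha(t)\,dt\ge\rho(b_n-a_n)$ for all $n$ and $\sum_{n=1}^\infty(b_n-a_n)^{2K_{(A,B)}+1}=\infty$. Then every solution $z(\cdot)$ of $\dot z(t)=Az(t)-\alpha(t)BB^\top z(t)$ satisfies $\|z(t)\|_{\mathbb{R}^N}\to0$ as $t\to\infty$.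
   Context: Solutions are understood in the Carathéodory (absolutely continuous) sense, equivalently $z(t)=e^{tA}z(0)-\int_0^te^{(t-s)A}\alpha(s)BB^\top z(s)\,ds$. Controllability of $(A,B)$ means $\operatorname{rank}[B,AB,\dots,A^{N-1}B]=N$. *)

theory Defs
  imports "HOL-Analysis.Analysis"
begin

text \<open>Matrix power A^k for square real matrices.\<close>
definition mpow :: "real^'n^'n \<Rightarrow> nat \<Rightarrow> real^'n^'n" where
  "mpow A k = ((\<lambda>M. A ** M) ^^ k) (mat 1)"

text \<open>Rank of the block matrix [B, AB, ..., A^K B]: the dimension of the span
  of its columns, i.e. of all columns of the blocks A^j B, j = 0..K.\<close>
definition kalman_rank :: "real^'n^'n \<Rightarrow> real^'r^'n \<Rightarrow> nat \<Rightarrow> nat" where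
  "kalman_rank A B K = dim (\<Union>j\<in>{..K}. columns (mpow A j ** B))"

text \<open>Controllability: rank [B, AB, ..., A^(N-1) B] = N.\<close>
definition controllable :: "real^'n^'n \<Rightarrow> real^'r^'n \<Rightarrow> bool" where
  "controllable A B \<longleftrightarrow> kalman_rank A B (CARD('n) - 1) = CARD('n)"

text \<open>K_(A,B): least non-negative K with rank [B, AB, ..., A^K B] = N.\<close>
definition kalman_index :: "real^'n^'n \<Rightarrow> real^'r^'n \<Rightarrow> nat" where
  "kalman_index A B = (LEAST K. kalman_rank A B K = CARD('n))"

text \<open>Caratheodory solution on [0,\<infinity>) of z' = A z - \<alpha>(t) B B^T z, in integral form.\<close>
definition is_solution :: "real^'n^'n \<Rightarrow> real^'r^'n \<Rightarrow> (real \<Rightarrow> real) \<Rightarrow> (real \<Rightarrow> real^'n) \<Rightarrow> bool" where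
  "is_solution A B \<alpha> z \<longleftrightarrow>
     (\<forall>t\<ge>0. ((\<lambda>s. A *v z s - \<alpha> s *\<^sub>R ((B ** transpose B) *v z s)) has_integral (z t - z 0)) {0..t})"

end

theory Submission
  imports Defs "HOL-Computational_Algebra.Polynomial"
begin

text \<open>The energy \<open>|z|\<^sup>2\<close> is nonincreasing and drops on \<open>[u, v]\<close> by twice the integral
  of \<open>\<alpha> |B\<^sup>T z|\<^sup>2\<close>. Let \<open>K = kalman_index A B\<close> and take a short interval \<open>[a, a + L]\<close> on which
  \<open>\<alpha>\<close> has mass at least \<open>\<rho> L\<close>. Either the dissipation there already exceeds
  \<open>L^(2K+1) |z a|\<^sup>2\<close>, or the feedback term is so small that \<open>z\<close> stays close to the degree-\<open>K\<close>
  Taylor polynomial of the free flow \<open>exp ((t - a) A) z a\<close>. By skew-symmetry and the Kalman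
  rank condition some output component of that polynomial has a coefficient of size
  \<open>\<ge> c |z a|\<close>; a polynomial with a large coefficient is small only on a set of small
  measure (Lagrange interpolation at well separated points), while \<open>\<alpha> \<ge> \<rho> / 2\<close> on a set
  of measure \<open>\<rho> L / 2\<close>. Hence the energy drops by at least \<open>c L^(2K+1) |z a|\<^sup>2\<close>. If \<open>|z|\<close>
  did not tend to \<open>0\<close>, summing these drops over the disjoint intervals would make
  \<open>\<Sum> (b\<^sub>n - a\<^sub>n)^(2K+1)\<close> converge.\<close>

section \<open>Polynomials with small values on a large set\<close>

lemma abs_coeff_prod_linear_le:
  fixes u :: "'a \<Rightarrow> real"
  assumes "finite S" "\<And>j. j \<in> S \<Longrightarrow> \<bar>u j\<bar> \<le> 1"
  shows "\<bar>coeff (\<Prod>j\<in>S. [:- u j, 1:]) n\<bar> \<le> 2 ^ card S"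
  using assms
proof (induction S arbitrary: n rule: finite_induct)
  case empty
  then show ?case by (cases n) auto
next
  case (insert i S)
  define Q where "Q = (\<Prod>j\<in>S. [:- u j, 1:])"
  have IH: "\<bar>coeff Q m\<bar> \<le> 2 ^ card S" for m
    using insert by (simp add: Q_def)
  have "\<bar>coeff (smult (- u i) Q) n\<bar> \<le> 1 * 2 ^ card S"
    unfolding coeff_smult abs_mult abs_minus_cancel
    using insert IH[of n] by (intro mult_mono) auto
  moreover have "\<bar>coeff (pCons 0 Q) n\<bar> \<le> 2 ^ card S"
    using IH by (cases n) auto
  moreover have "(\<Prod>j\<in>insert i S. [:- u j, 1:]) = smult (- u i) Q + pCons 0 Q"
    using insert by (simp add: Q_def mult_pCons_left)
  ultimately show ?case
    using insert abs_triangle_ineq[of "coeff (smult (- u i) Q) n" "coeff (pCons 0 Q) n"]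
    by simp
qed

lemma lagrange_interpolation:
  fixes p :: "real poly" and u :: "nat \<Rightarrow> real"
  assumes deg: "degree p \<le> K" and inj: "inj_on u {..K}"
  shows "p = (\<Sum>i\<le>K. smult (poly p (u i) / (\<Prod>j\<in>{..K}-{i}. u i - u j))
                              (\<Prod>j\<in>{..K}-{i}. [:- u j, 1:]))"
    (is "p = ?q")
proof (rule ccontr)
  assume "p \<noteq> ?q"
  then have nz: "p - ?q \<noteq> 0" by simp
  have deg_basis: "degree (\<Prod>j\<in>{..K}-{i}. [:- u j, 1:]) \<le> K" if "i \<le> K" for i
    using that degree_prod_sum_le[of "{..K}-{i}" "\<lambda>j. [:- u j, 1:]"] by (simp add: o_def)
  have "degree ?q \<le> K"
    using deg_basis by (intro degree_sum_le) (auto intro: order.trans[OF degree_smult_le])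
  then have deg_diff: "degree (p - ?q) \<le> K"
    using deg degree_diff_le by blast
  have nonzero: "(\<Prod>j\<in>{..K}-{i}. u i - u j) \<noteq> 0" if "i \<le> K" for i
    using inj that by (auto simp: inj_on_def)
  have "poly ?q (u k) = poly p (u k)" if "k \<le> K" for k
  proof -
    have "poly ?q (u k) = (\<Sum>i\<le>K. poly p (u i) / (\<Prod>j\<in>{..K}-{i}. u i - u j)
                                     * (\<Prod>j\<in>{..K}-{i}. u k - u j))"
      by (simp add: poly_sum poly_prod)
    also have "\<dots> = poly p (u k)"
      using that nonzero[OF that]
      by (subst sum.remove[of _ k]) (auto intro!: sum.neutral prod_zero)
    finally show ?thesis .
  qed
  then have "u ` {..K} \<subseteq> {x. poly (p - ?q) x = 0}"
    by auto
  then have "card (u ` {..K}) \<le> card {x. poly (p - ?q) x = 0}"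
    using poly_roots_finite[OF nz] by (rule card_mono[rotated])
  also have "\<dots> \<le> degree (p - ?q)"
    by (rule card_poly_roots_bound[OF nz])
  finally show False
    using deg_diff card_image[OF inj] by simp
qed

lemma abs_coeff_le_of_small_at_separated_points:
  fixes p :: "real poly" and u :: "nat \<Rightarrow> real"
  assumes deg: "degree p \<le> K"
    and u_le: "\<And>i. i \<le> K \<Longrightarrow> \<bar>u i\<bar> \<le> 1"
    and h: "0 < h"
    and sep: "\<And>i j. i \<le> K \<Longrightarrow> j \<le> K \<Longrightarrow> i \<noteq> j \<Longrightarrow> h \<le> \<bar>u i - u j\<bar>"
    and small: "\<And>i. i \<le> K \<Longrightarrow> \<bar>poly p (u i)\<bar> \<le> \<delta>"
  shows "\<bar>coeff p n\<bar> \<le> real (K + 1) * \<delta> * 2 ^ K / h ^ K"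
proof -
  define d where "d i = (\<Prod>j\<in>{..K}-{i}. u i - u j)" for i
  define N where "N i = (\<Prod>j\<in>{..K}-{i}. [:- u j, 1:])" for i
  have d_ge: "h ^ K \<le> \<bar>d i\<bar>" if "i \<le> K" for i
  proof -
    have "h ^ K = (\<Prod>j\<in>{..K}-{i}. h)"
      using that by simp
    also have "\<dots> \<le> \<bar>d i\<bar>"
      unfolding d_def abs_prod using sep that h by (intro prod_mono) auto
    finally show ?thesis .
  qed
  have term_le: "\<bar>poly p (u i) / d i * coeff (N i) n\<bar> \<le> \<delta> * 2 ^ K / h ^ K" if "i \<le> K" for i
  proof -
    have "\<bar>coeff (N i) n\<bar> \<le> 2 ^ K"
      using abs_coeff_prod_linear_le[of "{..K}-{i}" u n] u_le that by (simp add: N_def)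
    then show ?thesis
      using small[OF that] d_ge[OF that] h unfolding abs_mult abs_divide
      by (simp add: mult_imp_div_pos_le frac_le mult_mono)
  qed
  have "inj_on u {..K}"
    using sep h by (force simp: inj_on_def)
  then have "coeff p n = (\<Sum>i\<le>K. poly p (u i) / d i * coeff (N i) n)"
    by (subst lagrange_interpolation[OF deg]) (auto simp: coeff_sum d_def N_def)
  also have "\<bar>\<dots>\<bar> \<le> (\<Sum>i\<le>K. \<delta> * 2 ^ K / h ^ K)"
    using term_le by (intro order.trans[OF sum_abs] sum_mono) auto
  finally show ?thesis
    by simp
qed

lemma measure_Int_greaterThanAtMost_le:
  fixes G :: "real set"
  assumes "G \<in> sets lborel" "s \<le> t"
  shows "measure lborel (G \<inter> {s<..t}) \<le> t - s"
proof -
  have "measure lborel (G \<inter> {s<..t}) \<le> measure lborel {s<..t}"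
    using assms by (intro measure_mono_fmeasurable) (auto simp: fmeasurable_def)
  then show ?thesis
    using assms by simp
qed

lemma measure_Int_atMost_split:
  fixes G :: "real set"
  assumes "G \<in> sets lborel" "G \<subseteq> {a..b}" "s \<le> t"
  shows "measure lborel (G \<inter> {..t}) = measure lborel (G \<inter> {..s}) + measure lborel (G \<inter> {s<..t})"
proof -
  have fin: "G \<inter> S \<in> fmeasurable lborel" if "S \<in> sets lborel" for S
    by (rule fmeasurableI2[OF fmeasurable_compact[of "{a..b}"]]) (use assms that in auto)
  have "G \<inter> {..t} = (G \<inter> {..s}) \<union> (G \<inter> {s<..t})"
    using assms by auto
  then show ?thesis
    using fin[of "{..s}"] fin[of "{s<..t}"]
    by (simp only:) (intro measure_Union, auto simp: fmeasurable_def)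
qed

text \<open>The distribution function of \<open>G\<close> is 1-Lipschitz; apply the intermediate value theorem.\<close>

lemma exists_measure_Int_atMost_eq:
  fixes G :: "real set"
  assumes G: "G \<in> sets lborel" "G \<subseteq> {a..b}" and ab: "a \<le> b"
    and y: "0 \<le> y" "y \<le> measure lborel G"
  shows "\<exists>t\<in>{a..b}. measure lborel (G \<inter> {..t}) = y"
proof -
  define F where "F t = measure lborel (G \<inter> {..t})" for t
  have F_diff: "F t - F s \<le> t - s" "F s \<le> F t" if "s \<le> t" for s t
    using measure_Int_atMost_split[OF G that] measure_Int_greaterThanAtMost_le[OF G(1) that]
    by (simp_all add: F_def)
  have "1-lipschitz_on {a..b} F"
  proof (rule lipschitz_onI)
    fix s t
    show "dist (F s) (F t) \<le> 1 * dist s t"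
      using F_diff[of s t] F_diff[of t s] by (cases "s \<le> t") (auto simp: dist_real_def)
  qed simp
  then have "continuous_on {a..b} F"
    by (rule lipschitz_on_continuous_on)
  moreover have "F a = 0"
  proof -
    have "F a \<le> measure lborel {a..a}"
      unfolding F_def using G by (intro measure_mono_fmeasurable fmeasurable_compact) auto
    then show ?thesis
      using measure_nonneg[of lborel "G \<inter> {..a}"] by (simp add: F_def)
  qed
  moreover have "F b = measure lborel G"
    using G by (simp add: F_def Int_absorb2 subset_eq)
  ultimately obtain t where "a \<le> t" "t \<le> b" "F t = y"
    using IVT'[of F a y b] y ab by auto
  then show ?thesis
    unfolding F_def by auto
qed

lemma exists_point_between_levels:
  fixes G :: "real set"
  assumes G: "G \<in> sets lborel" "G \<subseteq> {a..b}" and h: "0 < h"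
    and levels: "measure lborel (G \<inter> {..u}) = y" "measure lborel (G \<inter> {..v}) = y + h"
  shows "\<exists>w\<in>G. y \<le> measure lborel (G \<inter> {..w}) \<and> measure lborel (G \<inter> {..w}) \<le> y + h"
proof -
  define F where "F t = measure lborel (G \<inter> {..t})" for t
  have mono: "F x \<le> F x'" if "x \<le> x'" for x x'
    using measure_Int_atMost_split[OF G that] by (simp add: F_def)
  have "u \<le> v"
    using mono[of v u] levels h by (fastforce simp: F_def)
  then have "measure lborel (G \<inter> {u<..v}) = h"
    using measure_Int_atMost_split[OF G, of u v] levels by simp
  then have "G \<inter> {u<..v} \<noteq> {}"
    using h by auto
  then obtain w where "w \<in> G" "u < w" "w \<le> v"
    by auto
  then show ?thesis
    using mono[of u w] mono[of w v] levels by (auto simp: F_def)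
qed

lemma exists_separated_points:
  fixes G :: "real set" and K :: nat
  assumes G: "G \<in> sets lborel" "G \<subseteq> {a..b}" and m: "0 < m" "m \<le> measure lborel G"
  shows "\<exists>u. (\<forall>i\<le>K. u i \<in> G) \<and>
             (\<forall>i\<le>K. \<forall>j\<le>K. i \<noteq> j \<longrightarrow> m / (2 * real K + 2) \<le> \<bar>u i - u j\<bar>)"
proof -
  define F where "F t = measure lborel (G \<inter> {..t})" for t
  define h where "h = m / (2 * real K + 2)"
  have h: "0 < h" "real (2 * K + 2) * h = m"
    using m by (auto simp: h_def field_simps)
  have mono: "F x \<le> F y" if "x \<le> y" for x y
    using measure_Int_atMost_split[OF G that] by (simp add: F_def)
  have "a \<le> b"
    using G m by (cases "G = {}") auto
  have "\<exists>t. i \<le> 2 * K + 2 \<longrightarrow> F t = real i * h" for i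
  proof (cases "i \<le> 2 * K + 2")
    case True
    then have "real i * h \<le> m"
      using h by (metis mult_right_mono of_nat_le_iff less_imp_le)
    then obtain t0 where "F t0 = real i * h"
      using exists_measure_Int_atMost_eq[OF G \<open>a \<le> b\<close>, of "real i * h"] h m
      unfolding F_def by fastforce
    then show ?thesis
      by blast
  qed simp
  then obtain t where t: "\<And>i. i \<le> 2 * K + 2 \<Longrightarrow> F (t i) = real i * h"
    by metis
  txt \<open>One point of \<open>G\<close> between the levels \<open>2 i h\<close> and \<open>(2 i + 1) h\<close> of \<open>F\<close> for each
    \<open>i\<close>: consecutive points are separated by a slab carrying mass \<open>h\<close> of \<open>G\<close>.\<close>
  have "\<exists>v. i \<le> K \<longrightarrow> v \<in> G \<and> real (2 * i) * h \<le> F v \<and> F v \<le> real (2 * i) * h + h" for i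
  proof (cases "i \<le> K")
    case True
    then have "F (t (2 * i)) = real (2 * i) * h" "F (t (2 * i + 1)) = real (2 * i) * h + h"
      using t[of "2 * i"] t[of "2 * i + 1"] by (simp_all add: algebra_simps)
    then show ?thesis
      using exists_point_between_levels[OF G h(1), where u = "t (2 * i)" and v = "t (2 * i + 1)"
          and y = "real (2 * i) * h"]
      unfolding F_def by auto
  qed simp
  then obtain u where u: "\<And>i. i \<le> K \<Longrightarrow> u i \<in> G \<and> real (2 * i) * h \<le> F (u i) \<and> F (u i) \<le> real (2 * i) * h + h"
    by metis
  have "h \<le> u j - u i" if "i < j" "j \<le> K" for i j
  proof -
    have "real (2 * i) + 1 + 1 \<le> real (2 * j)"
      using that by simp
    then have "(real (2 * i) + 1 + 1) * h \<le> real (2 * j) * h"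
      using h by (intro mult_right_mono) auto
    then have "real (2 * i) * h + h + h \<le> real (2 * j) * h"
      by (simp add: algebra_simps)
    then have Fij: "F (u i) + h \<le> F (u j)"
      using u[of i] u[of j] that by linarith
    then have "u i \<le> u j"
      using mono[of "u j" "u i"] h by fastforce
    then show ?thesis
      using Fij measure_Int_atMost_split[OF G \<open>u i \<le> u j\<close>]
        measure_Int_greaterThanAtMost_le[OF G(1) \<open>u i \<le> u j\<close>]
      by (simp add: F_def)
  qed
  note sep = this
  show ?thesis
  proof (intro exI[of _ u] conjI allI impI)
    fix i j
    assume "i \<le> K" "j \<le> K" "i \<noteq> j"
    then show "m / (2 * real K + 2) \<le> \<bar>u i - u j\<bar>"
      using sep[of i j] sep[of j i] unfolding h_def[symmetric] by (cases "i < j") auto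
  qed (use u in auto)
qed

lemma abs_coeff_le_of_small_on_set:
  fixes p :: "real poly" and G :: "real set"
  assumes G: "G \<in> sets lborel" "G \<subseteq> {a..a + 1}" and m: "0 < m" "m \<le> measure lborel G"
    and deg: "degree p \<le> K" and small: "\<And>s. s \<in> G \<Longrightarrow> \<bar>poly p (s - a)\<bar> \<le> \<delta>"
  shows "\<bar>coeff p n\<bar> \<le> real (K + 1) * \<delta> * 2 ^ K / (m / (2 * real K + 2)) ^ K"
proof -
  obtain u where u: "\<And>i. i \<le> K \<Longrightarrow> u i \<in> G"
    and sep: "\<And>i j. i \<le> K \<Longrightarrow> j \<le> K \<Longrightarrow> i \<noteq> j \<Longrightarrow> m / (2 * real K + 2) \<le> \<bar>u i - u j\<bar>"
    using exists_separated_points[OF G m, where K = K] by auto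
  show ?thesis
  proof (rule abs_coeff_le_of_small_at_separated_points[OF deg, where u = "\<lambda>i. u i - a"])
    show "\<bar>u i - a\<bar> \<le> 1" "\<bar>poly p (u i - a)\<bar> \<le> \<delta>" if "i \<le> K" for i
      using u[OF that] G(2) small by auto
  qed (use m sep in auto)
qed

lemma set_integrable_bounded_Icc:
  fixes g :: "real \<Rightarrow> real"
  assumes "g \<in> borel_measurable lborel" "\<And>s. s \<in> {u..v} \<Longrightarrow> \<bar>g s\<bar> \<le> C"
  shows "set_integrable lborel {u..v} g"
  unfolding set_integrable_def
  by (rule integrableI_bounded_set_indicator[where B = C])
    (use assms in \<open>auto simp: emeasure_lborel_Icc_eq\<close>)

lemma set_integrable_mult_continuous_on:
  fixes \<beta> \<phi> :: "real \<Rightarrow> real"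
  assumes "\<beta> \<in> borel_measurable lborel" "\<And>s. \<bar>\<beta> s\<bar> \<le> 1" "continuous_on {u..v} \<phi>"
  shows "set_integrable lborel {u..v} (\<lambda>s. \<beta> s * \<phi> s)"
proof -
  obtain C where C: "\<And>s. s \<in> {u..v} \<Longrightarrow> \<bar>\<phi> s\<bar> \<le> C"
    using compact_continuous_image[OF assms(3) compact_Icc]
    by (metis compact_imp_bounded bounded_real image_eqI)
  txt \<open>\<open>\<phi>\<close> is only continuous on \<open>{u..v}\<close>, so its measurable extension by zero is used.\<close>
  have "(\<lambda>s. \<beta> s * (indicator {u..v} s *\<^sub>R \<phi> s)) \<in> borel_measurable lborel"
    using assms(1) borel_measurable_continuous_on_indicator[OF _ assms(3)] by simp
  then have "set_integrable lborel {u..v} (\<lambda>s. \<beta> s * (indicator {u..v} s *\<^sub>R \<phi> s))"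
  proof (rule set_integrable_bounded_Icc)
    show "\<bar>\<beta> s * (indicator {u..v} s *\<^sub>R \<phi> s)\<bar> \<le> C" if "s \<in> {u..v}" for s
    proof -
      have "\<bar>\<beta> s\<bar> * \<bar>\<phi> s\<bar> \<le> 1 * C"
        using that assms(2)[of s] C[OF that] by (intro mult_mono) auto
      then show ?thesis
        using that by (simp add: abs_mult)
    qed
  qed
  then show ?thesis
    unfolding set_integrable_def
    by (rule Bochner_Integration.integrable_cong[THEN iffD1, rotated -1]) (auto simp: indicator_def)
qed

lemma set_integral_indicator_Icc:
  fixes E :: "real set"
  assumes "E \<in> sets lborel" "E \<subseteq> {u..v}"
  shows "(LINT s:{u..v}|lborel. indicator E s) = measure lborel E"
proof -
  have "(LINT s:{u..v}|lborel. indicator E s) = integral\<^sup>L lborel (indicator E :: real \<Rightarrow> real)"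
    unfolding set_lebesgue_integral_def using assms
    by (intro Bochner_Integration.integral_cong) (auto simp: indicator_def)
  then show ?thesis
    by simp
qed

lemma measure_superlevel_ge_of_mass:
  fixes \<beta> :: "real \<Rightarrow> real"
  assumes \<beta>: "\<beta> \<in> borel_measurable lborel" "\<And>s. 0 \<le> \<beta> s \<and> \<beta> s \<le> 1"
    and \<rho>: "0 \<le> \<rho>" and ab: "a \<le> b" and mass: "\<rho> * (b - a) \<le> (LINT s:{a..b}|lborel. \<beta> s)"
  shows "\<rho> * (b - a) / 2 \<le> measure lborel {s\<in>{a..b}. \<rho> / 2 \<le> \<beta> s}"
proof -
  define E where "E = {s\<in>{a..b}. \<rho> / 2 \<le> \<beta> s}"
  have E: "E \<in> sets lborel" "E \<subseteq> {a..b}"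
    unfolding E_def using \<beta>(1) by measurable auto
  have int_E: "set_integrable lborel {a..b} (indicator E :: real \<Rightarrow> real)"
    by (rule set_integrable_bounded_Icc[where C = 1]) (use E in auto)
  have int_const: "set_integrable lborel {a..b} (\<lambda>s. \<rho> / 2)"
    by (rule set_integrable_bounded_Icc[where C = "\<rho> / 2"]) (use \<rho> in auto)
  have "\<rho> * (b - a) \<le> (LINT s:{a..b}|lborel. indicator E s + \<rho> / 2)"
  proof (rule order.trans[OF mass set_integral_mono])
    show "set_integrable lborel {a..b} \<beta>"
      by (rule set_integrable_bounded_Icc[where C = 1]) (use \<beta> in auto)
    show "set_integrable lborel {a..b} (\<lambda>s. indicator E s + \<rho> / 2)"
      using int_E int_const by (rule set_integral_add)
    show "\<beta> s \<le> indicator E s + \<rho> / 2" if "s \<in> {a..b}" for s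
      using that \<beta>(2)[of s] \<rho> by (cases "\<rho> / 2 \<le> \<beta> s") (auto simp: E_def indicator_def)
  qed
  also have "\<dots> = measure lborel E + \<rho> / 2 * (b - a)"
    using set_integral_indicator_Icc[OF E] int_E int_const ab
    by (simp add: set_integral_const)
  finally show ?thesis
    by (simp add: E_def)
qed

definition poly_obs_const :: "nat \<Rightarrow> real \<Rightarrow> real" where
  "poly_obs_const K \<rho> = \<rho>^2 / 8 * (\<rho> / (8 * (real K + 1))) ^ (2 * K) / (4 * (real K + 1)^2 * 4 ^ K)"

lemma poly_obs_const_pos: "0 < \<rho> \<Longrightarrow> 0 < poly_obs_const K \<rho>"
  unfolding poly_obs_const_def by (intro divide_pos_pos mult_pos_pos zero_less_power) auto

lemma poly_obs_threshold:
  fixes \<rho> L \<gamma> :: real and K :: nat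
  defines "h \<equiv> \<rho> / (8 * (real K + 1)) * L"
  defines "\<delta> \<equiv> \<gamma> * h ^ K / (2 * (real K + 1) * 2 ^ K)"
  assumes "0 < h"
  shows "real (K + 1) * \<delta> * 2 ^ K / h ^ K = \<gamma> / 2"
    and "\<rho> / 2 * \<delta>^2 * (\<rho> * L / 4) = poly_obs_const K \<rho> * \<gamma>^2 * L^(2 * K + 1)"
proof -
  have hK: "0 < h ^ K" "0 < (2::real) ^ K" "0 < real K + 1"
    using assms(3) by auto
  have "real (K + 1) * \<delta> * 2 ^ K / h ^ K
        = (real K + 1) * 2 ^ K * h ^ K * \<gamma> / ((real K + 1) * 2 ^ K * h ^ K * 2)"
    unfolding \<delta>_def using hK by (simp add: field_simps)
  then show "real (K + 1) * \<delta> * 2 ^ K / h ^ K = \<gamma> / 2"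
    using hK assms(3) by simp
  have h2: "(h ^ K)^2 = (\<rho> / (8 * (real K + 1))) ^ (2 * K) * L ^ (2 * K)"
  proof -
    have "(h ^ K)^2 = ((\<rho> / (8 * (real K + 1))) ^ K)^2 * (L ^ K)^2"
      by (simp only: h_def power_mult_distrib)
    then show ?thesis
      by (simp add: mult.commute[of 2 K] flip: power_mult)
  qed
  have d2: "(2 * (real K + 1) * 2 ^ K)^2 = 4 * (real K + 1)^2 * 4 ^ K"
  proof -
    have "(4::real) ^ K = 2 ^ K * 2 ^ K"
      by (simp flip: power_mult_distrib)
    then show ?thesis
      by (simp add: power2_eq_square algebra_simps)
  qed
  have "\<delta>^2 = \<gamma>^2 * (\<rho> / (8 * (real K + 1))) ^ (2 * K) * L ^ (2 * K) / (4 * (real K + 1)^2 * 4 ^ K)"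
    unfolding \<delta>_def power_divide power_mult_distrib[of \<gamma>] h2 d2 by simp
  then show "\<rho> / 2 * \<delta>^2 * (\<rho> * L / 4) = poly_obs_const K \<rho> * \<gamma>^2 * L^(2 * K + 1)"
    by (simp add: poly_obs_const_def power2_eq_square)
qed

text \<open>The polynomial has absolute value at least \<open>\<delta>\<close> outside a set of measure \<open>\<rho> L / 4\<close>,
  while \<open>\<beta> \<ge> \<rho> / 2\<close> on a set of measure \<open>\<rho> L / 2\<close>.\<close>

lemma poly_observability:
  fixes \<beta> :: "real \<Rightarrow> real" and p :: "real poly"
  assumes \<beta>: "\<beta> \<in> borel_measurable lborel" "\<And>s. 0 \<le> \<beta> s \<and> \<beta> s \<le> 1"
    and \<rho>: "0 < \<rho>" and L: "0 < L" "L \<le> 1"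
    and mass: "\<rho> * L \<le> (LINT s:{a..a + L}|lborel. \<beta> s)"
    and deg: "degree p \<le> K" and \<gamma>: "0 < \<gamma>" "\<gamma> \<le> \<bar>coeff p j\<bar>"
  shows "poly_obs_const K \<rho> * \<gamma>^2 * L^(2 * K + 1)
           \<le> (LINT s:{a..a + L}|lborel. \<beta> s * (poly p (s - a))^2)"
proof -
  define P where "P s = poly p (s - a)" for s
  define h where "h = \<rho> / (8 * (real K + 1)) * L"
  define \<delta> where "\<delta> = \<gamma> * h ^ K / (2 * (real K + 1) * 2 ^ K)"
  define E where "E = {s\<in>{a..a + L}. \<rho> / 2 \<le> \<beta> s}"
  define S where "S = {s\<in>E. \<delta>^2 \<le> (P s)^2}"
  have h: "0 < h" "\<rho> * L / 4 / (2 * real K + 2) = h"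
    using \<rho> L by (auto simp: h_def field_simps)
  have \<delta>: "0 < \<delta>"
    using \<gamma> h by (simp add: \<delta>_def)
  have P_cont: "continuous_on UNIV P"
    unfolding P_def by (intro continuous_intros)
  then have P_meas: "P \<in> borel_measurable lborel"
    by (simp add: borel_measurable_continuous_onI)
  have "E \<in> sets lborel" "S \<in> sets lborel"
    unfolding S_def E_def using \<beta>(1) P_meas by measurable
  then have E: "E \<in> sets lborel" "E \<subseteq> {a..a + L}" and S: "S \<in> sets lborel" "S \<subseteq> {a..a + L}"
    by (auto simp: E_def S_def)
  have "measure lborel (E - S) < \<rho> * L / 4"
  proof (rule ccontr)
    assume "\<not> ?thesis"
    then have "\<bar>coeff p j\<bar> \<le> real (K + 1) * \<delta> * 2 ^ K / h ^ K"
      unfolding h(2)[symmetric]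
    proof (intro abs_coeff_le_of_small_on_set[OF _ _ _ _ deg])
      show "\<bar>poly p (s - a)\<bar> \<le> \<delta>" if "s \<in> E - S" for s
        using that \<delta> by (auto simp: S_def P_def abs_le_square_iff[symmetric] abs_of_pos)
    qed (use E S L \<rho> in auto)
    also have "\<dots> = \<gamma> / 2"
      using poly_obs_threshold(1) h by (simp add: h_def \<delta>_def)
    finally show False
      using \<gamma> by simp
  qed
  moreover have "measure lborel E = measure lborel (E - S) + measure lborel S"
  proof -
    have "E \<in> fmeasurable lborel"
      by (rule fmeasurableI2[OF fmeasurable_compact[of "{a..a + L}"]]) (use E in auto)
    then show ?thesis
      using S by (subst measure_Diff) (auto simp: S_def fmeasurable_def)
  qed
  moreover have "\<rho> * L / 2 \<le> measure lborel E"
    using measure_superlevel_ge_of_mass[OF \<beta> _ _ , of \<rho> a "a + L"] \<rho> L mass by (simp add: E_def)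
  ultimately have measS: "\<rho> * L / 4 \<le> measure lborel S"
    by linarith
  have "\<rho> / 2 * \<delta>^2 * (\<rho> * L / 4) \<le> (LINT s:{a..a + L}|lborel. \<rho> / 2 * \<delta>^2 * indicator S s)"
  proof -
    have "\<delta>^2 * (\<rho> * L) \<le> \<delta>^2 * (measure lborel S * 4)"
      using measS by (intro mult_left_mono) auto
    then show ?thesis
      using set_integral_indicator_Icc[OF S] \<rho> by (simp add: algebra_simps)
  qed
  also have "\<dots> \<le> (LINT s:{a..a + L}|lborel. \<beta> s * (P s)^2)"
  proof (rule set_integral_mono)
    show "set_integrable lborel {a..a + L} (\<lambda>s. \<rho> / 2 * \<delta>^2 * indicator S s)"
      by (rule set_integrable_bounded_Icc[where C = "\<rho> / 2 * \<delta>^2"]) (use S \<rho> in \<open>auto simp: indicator_def\<close>)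
    show "set_integrable lborel {a..a + L} (\<lambda>s. \<beta> s * (P s)^2)"
      using \<beta> by (intro set_integrable_mult_continuous_on continuous_on_subset[OF P_cont]
          continuous_intros) auto
    show "\<rho> / 2 * \<delta>^2 * indicator S s \<le> \<beta> s * (P s)^2" for s
    proof (cases "s \<in> S")
      case True
      then have "\<rho> / 2 * \<delta>^2 \<le> \<beta> s * (P s)^2"
        using \<rho> by (intro mult_mono) (auto simp: S_def E_def)
      then show ?thesis
        using True by simp
    qed (use \<beta>(2)[of s] in simp)
  qed
  also have "\<rho> / 2 * \<delta>^2 * (\<rho> * L / 4) = poly_obs_const K \<rho> * \<gamma>^2 * L^(2 * K + 1)"
    using poly_obs_threshold(2) h by (simp add: h_def \<delta>_def)
  finally show ?thesis
    by (simp add: P_def)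
qed

section \<open>Energy dissipation\<close>

lemma matrix_vector_mult_uminus: "(- C) *v y = - (C *v y)"
  for C :: "'a::comm_ring_1^'n^'m"
  by (simp add: matrix_vector_mult_def vec_eq_iff sum_negf)

lemma norm_matrix_vector_mult_le: "norm (C *v y) \<le> onorm ((*v) C) * norm y"
  for C :: "real^'n^'m"
  by (rule onorm[OF matrix_vector_mul_bounded_linear])

lemma onorm_matrix_vector_mult_nonneg: "0 \<le> onorm ((*v) C)"
  for C :: "real^'n^'m"
  by (rule onorm_pos_le[OF matrix_vector_mul_bounded_linear])

lemma inner_skew_symmetric_eq_0:
  fixes A :: "real^'n^'n"
  assumes "transpose A = - A"
  shows "y \<bullet> (A *v y) = 0"
proof -
  have "y \<bullet> (A *v y) = (y v* A) \<bullet> y"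
    by (simp add: dot_lmul_matrix)
  also have "y v* A = transpose A *v y"
    using vector_transpose_matrix[of y "transpose A"] by simp
  also have "\<dots> = - (A *v y)"
    using assms by (simp add: matrix_vector_mult_uminus)
  finally show ?thesis
    by (simp add: inner_commute)
qed

lemma inner_mult_transpose: "y \<bullet> ((B ** transpose B) *v y) = (norm (transpose B *v y))^2"
  for B :: "real^'r^'n"
proof -
  have "y \<bullet> ((B ** transpose B) *v y) = y \<bullet> (B *v (transpose B *v y))"
    by (simp only: matrix_vector_mul_assoc)
  also have "\<dots> = (y v* B) \<bullet> (transpose B *v y)"
    by (rule dot_lmul_matrix[symmetric])
  also have "y v* B = transpose B *v y"
    using vector_transpose_matrix[of y "transpose B"] by simp
  finally show ?thesis
    by (simp only: power2_norm_eq_inner)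
qed

lemma eq_if_increment_le_square:
  fixes \<Phi> :: "real \<Rightarrow> real"
  assumes ab: "a \<le> b"
    and incr: "\<And>u v. a \<le> u \<Longrightarrow> u \<le> v \<Longrightarrow> v \<le> b \<Longrightarrow> \<bar>\<Phi> v - \<Phi> u\<bar> \<le> C * (v - u)^2"
  shows "\<Phi> b = \<Phi> a"
proof -
  have bound: "\<bar>\<Phi> b - \<Phi> a\<bar> \<le> C * (b - a)^2 / real n" if "n > 0" for n
  proof -
    define p where "p i = a + real i * (b - a) / real n" for i
    have p_step: "p (Suc i) - p i = (b - a) / real n" for i
      by (simp add: p_def diff_divide_distrib[symmetric] algebra_simps)
    have p_ge: "a \<le> p i" for i
      using ab by (simp add: p_def)
    have p_le: "p i \<le> b" if "i \<le> n" for i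
    proof -
      have "real i * (b - a) \<le> real n * (b - a)"
        using ab that by (intro mult_right_mono) auto
      then show ?thesis
        using \<open>n > 0\<close> by (simp add: p_def field_simps)
    qed
    have "\<Phi> b - \<Phi> a = (\<Sum>i<n. \<Phi> (p (Suc i)) - \<Phi> (p i))"
      using sum_lessThan_telescope[of "\<lambda>i. \<Phi> (p i)" n] that by (simp add: p_def)
    also have "\<bar>\<dots>\<bar> \<le> (\<Sum>i<n. C * ((b - a) / real n)^2)"
    proof (intro order.trans[OF sum_abs] sum_mono)
      fix i
      assume "i \<in> {..<n}"
      have "0 \<le> (b - a) / real n"
        using ab by simp
      then have "p i \<le> p (Suc i)"
        using p_step[of i] by linarith
      then show "\<bar>\<Phi> (p (Suc i)) - \<Phi> (p i)\<bar> \<le> C * ((b - a) / real n)^2"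
        using incr[of "p i" "p (Suc i)"] p_step[of i] p_ge[of i] p_le[of "Suc i"] \<open>i \<in> {..<n}\<close>
        by simp
    qed
    also have "\<dots> = C * (b - a)^2 / real n"
      using that by (simp add: power2_eq_square field_simps)
    finally show ?thesis .
  qed
  show ?thesis
  proof (rule ccontr)
    define e where "e = \<bar>\<Phi> b - \<Phi> a\<bar>"
    assume "\<Phi> b \<noteq> \<Phi> a"
    then have e: "0 < e"
      by (simp add: e_def)
    obtain n :: nat where n: "max 1 (C * (b - a)^2 / e) < real n"
      using reals_Archimedean2 by blast
    then have "0 < n"
      by simp
    then have "e * real n \<le> C * (b - a)^2"
      using bound[of n] by (simp add: e_def pos_le_divide_eq)
    moreover have "C * (b - a)^2 < e * real n"
      using n e by (simp add: pos_divide_less_eq mult.commute)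
    ultimately show False
      by simp
  qed
qed

locale damped_skew_system =
  fixes A :: "real^'n^'n" and B :: "real^'r^'n" and \<alpha> :: "real \<Rightarrow> real" and z :: "real \<Rightarrow> real^'n"
  assumes skew: "transpose A = - A"
    and alpha_meas: "\<alpha> \<in> borel_measurable (restrict_space lborel {0..})"
    and alpha_range: "\<And>t. t \<ge> 0 \<Longrightarrow> 0 \<le> \<alpha> t \<and> \<alpha> t \<le> 1"
    and sol: "is_solution A B \<alpha> z"
begin

text \<open>\<open>\<alpha>\<close> extended by zero to a Borel function on the whole line.\<close>

definition "damping s = indicator {0..} s * \<alpha> s"
definition "rhs s = A *v z s - \<alpha> s *\<^sub>R ((B ** transpose B) *v z s)"
definition "energy t = (norm (z t))^2"
definition "observed s = transpose B *v z s"
definition "dissipation s = damping s * (norm (observed s))^2"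

lemma damping_measurable: "damping \<in> borel_measurable lborel"
proof -
  have "(\<lambda>x. indicator {0..} x *\<^sub>R \<alpha> x) \<in> borel_measurable lborel"
    using alpha_meas by (subst borel_measurable_restrict_space_iff[symmetric]) auto
  then show ?thesis
    by (simp add: damping_def[abs_def])
qed

lemma damping_range: "0 \<le> damping s \<and> damping s \<le> 1"
  using alpha_range[of s] by (auto simp: damping_def indicator_def)

lemma damping_eq: "0 \<le> s \<Longrightarrow> damping s = \<alpha> s"
  by (simp add: damping_def)

lemma has_integral_rhs:
  assumes "0 \<le> u" "u \<le> v"
  shows "(rhs has_integral (z v - z u)) {u..v}"
proof -
  have int0: "(rhs has_integral (z t - z 0)) {0..t}" if "0 \<le> t" for t
    using sol that unfolding is_solution_def rhs_def by auto
  have "0 \<le> v"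
    using assms by simp
  have "rhs integrable_on {u..v}"
    by (rule integrable_subinterval_real[OF has_integral_integrable[OF int0[OF \<open>0 \<le> v\<close>]]])
      (use assms in auto)
  moreover have "integral {0..u} rhs + integral {u..v} rhs = integral {0..v} rhs"
    using assms int0[OF \<open>0 \<le> v\<close>] by (intro Henstock_Kurzweil_Integration.integral_combine) auto
  then have "integral {u..v} rhs = integral {0..v} rhs - integral {0..u} rhs"
    by (simp add: algebra_simps)
  then have "integral {u..v} rhs = z v - z u"
    using int0[OF \<open>0 \<le> v\<close>] int0[OF assms(1)] by (simp add: integral_unique)
  ultimately show ?thesis
    by (simp add: has_integral_iff)
qed

lemma continuous_on_z: "0 \<le> u \<Longrightarrow> continuous_on {u..v} z"
proof (cases "u \<le> v")
  case True
  assume "0 \<le> u"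
  have "continuous_on {u..v} (\<lambda>t. z u + integral {u..t} rhs)"
    using has_integral_rhs[OF \<open>0 \<le> u\<close> True]
    by (intro continuous_intros indefinite_integral_continuous_1) blast
  moreover have "z u + integral {u..t} rhs = z t" if "t \<in> {u..v}" for t
  proof -
    have "integral {u..t} rhs = z t - z u"
      using has_integral_rhs[of u t] that \<open>0 \<le> u\<close> by (auto intro: integral_unique)
    then show ?thesis
      by simp
  qed
  ultimately show ?thesis
    using continuous_on_cong by (metis (no_types, lifting))
qed simp

lemma norm_z_bounded: obtains Z where "0 \<le> Z" "\<And>s. s \<in> {0..T} \<Longrightarrow> norm (z s) \<le> Z"
proof -
  have "compact (z ` {0..T})"
    by (intro compact_continuous_image continuous_on_z) auto
  then have "bounded (z ` {0..T})"
    by (rule compact_imp_bounded)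
  then obtain Z where "\<forall>y\<in>z ` {0..T}. norm y \<le> Z"
    by (auto simp: bounded_iff)
  then show ?thesis
    by (intro that[of "max Z 0"]) (auto intro: max.coboundedI1)
qed

lemma norm_rhs_bounded: obtains C where "\<And>s. s \<in> {0..T} \<Longrightarrow> norm (rhs s) \<le> C"
proof -
  obtain Z where Z: "0 \<le> Z" "\<And>s. s \<in> {0..T} \<Longrightarrow> norm (z s) \<le> Z"
    using norm_z_bounded by blast
  define cA cM where "cA = onorm ((*v) A)" and "cM = onorm ((*v) (B ** transpose B))"
  have c: "0 \<le> cA" "0 \<le> cM"
    by (simp_all add: cA_def cM_def onorm_matrix_vector_mult_nonneg)
  have "norm (rhs s) \<le> cA * Z + cM * Z" if "s \<in> {0..T}" for s
  proof -
    have "norm (rhs s) \<le> norm (A *v z s) + \<alpha> s * norm ((B ** transpose B) *v z s)"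
      unfolding rhs_def using alpha_range[of s] that
        norm_triangle_ineq4[of "A *v z s" "\<alpha> s *\<^sub>R ((B ** transpose B) *v z s)"] by simp
    also have "\<dots> \<le> cA * norm (z s) + 1 * (cM * norm (z s))"
    proof (rule add_mono)
      show "norm (A *v z s) \<le> cA * norm (z s)"
        unfolding cA_def by (rule norm_matrix_vector_mult_le)
      show "\<alpha> s * norm ((B ** transpose B) *v z s) \<le> 1 * (cM * norm (z s))"
        unfolding cM_def using alpha_range[of s] that norm_matrix_vector_mult_le
        by (intro mult_mono) auto
    qed
    also have "\<dots> \<le> cA * Z + cM * Z"
      using Z(2)[OF that] c by (auto intro!: add_mono mult_left_mono)
    finally show ?thesis .
  qed
  then show ?thesis
    using that by blast
qed

lemma inner_z_rhs: "0 \<le> s \<Longrightarrow> z s \<bullet> rhs s = - dissipation s"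
  by (simp add: rhs_def dissipation_def observed_def inner_diff_right damping_eq
      inner_skew_symmetric_eq_0[OF skew] inner_mult_transpose)

lemma dissipation_nonneg: "0 \<le> dissipation s"
  using damping_range[of s] by (simp add: dissipation_def)

lemma set_integrable_dissipation: "0 \<le> u \<Longrightarrow> set_integrable lborel {u..v} dissipation"
  unfolding dissipation_def observed_def
  using damping_measurable damping_range
  by (intro set_integrable_mult_continuous_on continuous_intros
      linear_continuous_on_compose[OF continuous_on_z matrix_vector_mul_linear]) auto

lemma integrable_dissipation: "0 \<le> u \<Longrightarrow> dissipation integrable_on {u..v}"
  using set_integrable_dissipation set_borel_integral_eq_integral(1) by blast

lemma norm_z_diff_le:
  assumes C: "\<And>s. s \<in> {u..v} \<Longrightarrow> norm (rhs s) \<le> C" and uv: "0 \<le> u" "u \<le> v"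
  shows "norm (z v - z u) \<le> C * (v - u)"
proof -
  have "0 \<le> C"
    using order.trans[OF norm_ge_zero C[of u]] uv by simp
  then have "norm (z v - z u) \<le> C * measure lborel (cbox u v)"
    using has_integral_rhs[OF uv] C by (intro has_integral_bound[of C rhs]) auto
  then show ?thesis
    using uv by simp
qed

text \<open>Both \<open>z u \<bullet> (z v - z u)\<close> and \<open>- \<integral>\<^sub>u\<^sup>v dissipation\<close> equal
  \<open>\<integral>\<^sub>u\<^sup>v z s \<bullet> rhs s\<close> up to an error of order \<open>(v - u)\<^sup>2\<close>.\<close>

lemma abs_inner_increment_add_dissipation_le:
  assumes C: "\<And>s. s \<in> {u..v} \<Longrightarrow> norm (rhs s) \<le> C" and uv: "0 \<le> u" "u \<le> v"
  shows "\<bar>z u \<bullet> (z v - z u) + integral {u..v} dissipation\<bar> \<le> C^2 * (v - u)^2"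
proof -
  have "0 \<le> C"
    using order.trans[OF norm_ge_zero C[of u]] uv by simp
  define I where "I = integral {u..v} dissipation"
  have "((\<lambda>s. z u \<bullet> rhs s + dissipation s) has_integral (z u \<bullet> (z v - z u) + I)) {u..v}"
    unfolding I_def using uv integrable_dissipation[of u v]
      has_integral_linear[OF has_integral_rhs[OF uv] bounded_linear_inner_right[of "z u"]]
    by (intro has_integral_add) (auto simp: o_def)
  moreover have "z u \<bullet> rhs s + dissipation s = (z u - z s) \<bullet> rhs s" if "s \<in> {u..v}" for s
    using inner_z_rhs[of s] that uv by (simp add: inner_diff_left)
  ultimately have "((\<lambda>s. (z u - z s) \<bullet> rhs s) has_integral (z u \<bullet> (z v - z u) + I)) {u..v}"
    using has_integral_cong[of "{u..v}" "\<lambda>s. z u \<bullet> rhs s + dissipation s"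
        "\<lambda>s. (z u - z s) \<bullet> rhs s" "z u \<bullet> (z v - z u) + I"] by blast
  then have int: "((\<lambda>s. (z u - z s) \<bullet> rhs s) has_integral (z u \<bullet> (z v - z u) + I)) (cbox u v)"
    by simp
  have "norm (z u \<bullet> (z v - z u) + I) \<le> (C * (v - u) * C) * measure lborel (cbox u v)"
  proof (rule has_integral_bound[OF _ int])
    fix s
    assume "s \<in> cbox u v"
    then have s: "u \<le> s" "s \<le> v"
      by auto
    have "norm (z s - z u) \<le> C * (s - u)"
      using C s uv by (intro norm_z_diff_le) auto
    also have "\<dots> \<le> C * (v - u)"
      using s \<open>0 \<le> C\<close> by (intro mult_left_mono) auto
    finally have "norm (z u - z s) \<le> C * (v - u)"
      by (simp add: norm_minus_commute)
    moreover have "norm (rhs s) \<le> C"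
      using C s by simp
    ultimately have "norm (z u - z s) * norm (rhs s) \<le> C * (v - u) * C"
      using \<open>0 \<le> C\<close> uv by (intro mult_mono) auto
    then show "norm ((z u - z s) \<bullet> rhs s) \<le> C * (v - u) * C"
      using Cauchy_Schwarz_ineq2[of "z u - z s" "rhs s"] by simp
  qed (use \<open>0 \<le> C\<close> uv in simp)
  then show ?thesis
    using uv by (simp add: I_def power2_eq_square mult_ac)
qed

lemma energy_increment_le:
  assumes C: "\<And>s. s \<in> {u..v} \<Longrightarrow> norm (rhs s) \<le> C" and uv: "0 \<le> u" "u \<le> v"
  shows "\<bar>energy v - energy u + 2 * integral {u..v} dissipation\<bar> \<le> 3 * (C^2 * (v - u)^2)"
proof -
  define d where "d = z v - z u"
  define I where "I = integral {u..v} dissipation"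
  have X: "\<bar>z u \<bullet> d + I\<bar> \<le> C^2 * (v - u)^2"
    unfolding d_def I_def using C uv by (rule abs_inner_increment_add_dissipation_le)
  have "norm d \<le> C * (v - u)"
    unfolding d_def using C uv by (rule norm_z_diff_le)
  then have N: "(norm d)^2 \<le> C^2 * (v - u)^2"
    using power_mono[of "norm d" "C * (v - u)" 2] by (simp add: power_mult_distrib)
  have aux: "\<bar>2 * x + n\<bar> \<le> 3 * q" if "\<bar>x\<bar> \<le> q" "n \<le> q" "0 \<le> n" for x q n :: real
    using that by arith
  have "\<bar>2 * (z u \<bullet> d + I) + (norm d)^2\<bar> \<le> 3 * (C^2 * (v - u)^2)"
    by (rule aux[OF X N]) simp
  moreover have "energy v - energy u + 2 * I = 2 * (z u \<bullet> d + I) + (norm d)^2"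
    unfolding energy_def d_def power2_norm_eq_inner
    by (simp add: inner_diff_left inner_diff_right inner_commute algebra_simps)
  ultimately show ?thesis
    unfolding I_def by simp
qed

lemma energy_identity:
  assumes "0 \<le> u" "u \<le> v"
  shows "energy u - energy v = 2 * integral {u..v} dissipation"
proof -
  obtain C where C: "\<And>s. s \<in> {0..v} \<Longrightarrow> norm (rhs s) \<le> C"
    using norm_rhs_bounded by blast
  define \<Phi> where "\<Phi> s = energy s + 2 * integral {u..s} dissipation" for s
  have "\<Phi> v = \<Phi> u"
  proof (rule eq_if_increment_le_square[OF assms(2)])
    fix s t
    assume st: "u \<le> s" "s \<le> t" "t \<le> v"
    have "integral {u..s} dissipation + integral {s..t} dissipation = integral {u..t} dissipation"
      using st assms integrable_dissipation[of u t]
      by (intro Henstock_Kurzweil_Integration.integral_combine) auto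
    then have "\<Phi> t - \<Phi> s = energy t - energy s + 2 * integral {s..t} dissipation"
      by (simp add: \<Phi>_def algebra_simps)
    then show "\<bar>\<Phi> t - \<Phi> s\<bar> \<le> 3 * C^2 * (t - s)^2"
      using energy_increment_le[of s t C] C st assms by (simp add: mult.assoc)
  qed
  then show ?thesis
    by (simp add: \<Phi>_def)
qed

lemma energy_antimono:
  assumes "0 \<le> u" "u \<le> v"
  shows "energy v \<le> energy u"
proof -
  have "0 \<le> integral {u..v} dissipation"
    using integrable_dissipation[OF assms(1)] dissipation_nonneg by (rule integral_nonneg)
  then show ?thesis
    using energy_identity[OF assms] by simp
qed

lemma norm_z_antimono: "0 \<le> u \<Longrightarrow> u \<le> v \<Longrightarrow> norm (z v) \<le> norm (z u)"
  using energy_antimono by (simp add: energy_def power_mono_iff)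

end

section \<open>Taylor approximation of the free flow\<close>

lemma mpow_0 [simp]: "mpow A 0 = mat 1"
  by (simp add: mpow_def)

lemma mpow_Suc: "mpow A (Suc j) = A ** mpow A j"
  by (simp add: mpow_def)

text \<open>The Taylor polynomial of degree \<open>k\<close> at \<open>a\<close> of the free flow \<open>t \<mapsto> exp ((t - a) A) x\<close>.\<close>

definition exp_taylor :: "real^'n^'n \<Rightarrow> real^'n \<Rightarrow> real \<Rightarrow> nat \<Rightarrow> real \<Rightarrow> real^'n" where
  "exp_taylor A x a k t = (\<Sum>j\<le>k. ((t - a)^j / fact j) *\<^sub>R (mpow A j *v x))"

lemma exp_taylor_0 [simp]: "exp_taylor A x a 0 t = x"
  by (simp add: exp_taylor_def)

lemma exp_taylor_at_base [simp]: "exp_taylor A x a k a = x"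
  by (induction k) (auto simp: exp_taylor_def)

lemma has_vector_derivative_exp_taylor:
  "(exp_taylor A x a (Suc k) has_vector_derivative (A *v exp_taylor A x a k t)) (at t within S)"
proof -
  define v where "v j = mpow A j *v x" for j
  define g where "g j = (real j * (t - a)^(j - 1) / fact j) *\<^sub>R v j" for j
  have "((\<lambda>t. ((t - a)^j / fact j) *\<^sub>R v j) has_vector_derivative g j) (at t within S)" for j
    unfolding g_def by (auto intro!: derivative_eq_intros simp: field_simps)
  then have "(exp_taylor A x a (Suc k) has_vector_derivative (\<Sum>j\<le>Suc k. g j)) (at t within S)"
    unfolding exp_taylor_def v_def[symmetric] by (rule has_vector_derivative_sum)
  moreover have "(\<Sum>j\<le>Suc k. g j) = A *v exp_taylor A x a k t"
  proof -
    have "(\<Sum>j\<le>Suc k. g j) = (\<Sum>j\<le>k. ((t - a)^j / fact j) *\<^sub>R v (Suc j))"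
      by (subst sum.atMost_Suc_shift) (simp add: g_def)
    also have "\<dots> = A *v exp_taylor A x a k t"
      by (simp add: exp_taylor_def vec.sum matrix_vector_mult_scaleR v_def mpow_Suc
          matrix_vector_mul_assoc)
    finally show ?thesis .
  qed
  ultimately show ?thesis
    by simp
qed

lemma continuous_on_exp_taylor: "continuous_on S (exp_taylor A x a k)"
  unfolding exp_taylor_def by (intro continuous_intros) auto

lemma norm_integral_matrix_vector_mult_le:
  fixes A :: "real^'n^'m" and y :: "real \<Rightarrow> real^'n"
  assumes "continuous_on {a..t} y" "a \<le> t" "\<And>s. s \<in> {a..t} \<Longrightarrow> norm (y s) \<le> Y"
  shows "norm (integral {a..t} (\<lambda>s. A *v y s)) \<le> onorm ((*v) A) * Y * (t - a)"
proof -
  have "0 \<le> Y"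
    using order.trans[OF norm_ge_zero assms(3)[of a]] assms(2) by simp
  then have "norm (integral {a..t} (\<lambda>s. A *v y s)) \<le> (onorm ((*v) A) * Y) * measure lborel (cbox a t)"
  proof (intro has_integral_bound)
    have "(\<lambda>s. A *v y s) integrable_on {a..t}"
      using assms(1) by (intro integrable_continuous_real
          linear_continuous_on_compose[OF _ matrix_vector_mul_linear])
    then show "((\<lambda>s. A *v y s) has_integral integral {a..t} (\<lambda>s. A *v y s)) (cbox a t)"
      by (simp add: has_integral_integral)
    show "norm (A *v y s) \<le> onorm ((*v) A) * Y" if "s \<in> cbox a t" for s
    proof -
      have "norm (A *v y s) \<le> onorm ((*v) A) * norm (y s)"
        by (rule norm_matrix_vector_mult_le)
      also have "\<dots> \<le> onorm ((*v) A) * Y"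
        using that assms(3)[of s] onorm_matrix_vector_mult_nonneg by (intro mult_left_mono) auto
      finally show ?thesis .
    qed
  qed (simp add: onorm_matrix_vector_mult_nonneg)
  then show ?thesis
    using assms(2) by simp
qed

primrec taylor_error_const :: "real \<Rightarrow> nat \<Rightarrow> real" where
  "taylor_error_const c 0 = c + 1"
| "taylor_error_const c (Suc k) = c * taylor_error_const c k + 1"

lemma taylor_error_const_nonneg: "0 \<le> c \<Longrightarrow> 0 \<le> taylor_error_const c k"
  by (induction k) auto

context damped_skew_system
begin

definition "feedback s = \<alpha> s *\<^sub>R ((B ** transpose B) *v z s)"

lemma has_integral_feedback:
  assumes "0 \<le> u" "u \<le> v"
  shows "(feedback has_integral (integral {u..v} (\<lambda>s. A *v z s) - (z v - z u))) {u..v}"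
proof -
  have "(\<lambda>s. A *v z s) integrable_on {u..v}"
    using assms(1) by (intro integrable_continuous_real
        linear_continuous_on_compose[OF continuous_on_z matrix_vector_mul_linear])
  then have "((\<lambda>s. A *v z s - rhs s) has_integral
                (integral {u..v} (\<lambda>s. A *v z s) - (z v - z u))) {u..v}"
    by (intro has_integral_diff has_integral_rhs[OF assms]) (simp add: has_integral_integral)
  moreover have "A *v z s - rhs s = feedback s" for s
    by (simp add: rhs_def feedback_def)
  ultimately show ?thesis
    by simp
qed

lemma z_diff_eq_integral:
  assumes "0 \<le> u" "u \<le> v"
  shows "z v - z u = integral {u..v} (\<lambda>s. A *v z s) - integral {u..v} feedback"
  using integral_unique[OF has_integral_feedback[OF assms]] by simp

lemma z_minus_exp_taylor_Suc:
  assumes "0 \<le> a" "a \<le> t"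
  shows "z t - exp_taylor A (z a) a (Suc k) t
           = integral {a..t} (\<lambda>s. A *v (z s - exp_taylor A (z a) a k s)) - integral {a..t} feedback"
proof -
  have ftc: "((\<lambda>s. A *v exp_taylor A (z a) a k s) has_integral
               (exp_taylor A (z a) a (Suc k) t - z a)) {a..t}"
    using fundamental_theorem_of_calculus[OF assms(2), of "exp_taylor A (z a) a (Suc k)"]
      has_vector_derivative_exp_taylor by fastforce
  have "(\<lambda>s. A *v z s) integrable_on {a..t}"
    using assms(1) by (intro integrable_continuous_real
        linear_continuous_on_compose[OF continuous_on_z matrix_vector_mul_linear])
  then have "integral {a..t} (\<lambda>s. A *v (z s - exp_taylor A (z a) a k s))
      = integral {a..t} (\<lambda>s. A *v z s) - (exp_taylor A (z a) a (Suc k) t - z a)"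
    using ftc by (simp add: matrix_vector_mult_diff_distrib integral_diff has_integral_integrable
        integral_unique)
  then show ?thesis
    using z_diff_eq_integral[OF assms] by (simp add: algebra_simps)
qed

lemma norm_z_diff_le_feedback:
  assumes "0 \<le> a" "a \<le> t"
  shows "norm (z t - z a) \<le> onorm ((*v) A) * norm (z a) * (t - a) + norm (integral {a..t} feedback)"
proof -
  have "norm (integral {a..t} (\<lambda>s. A *v z s)) \<le> onorm ((*v) A) * norm (z a) * (t - a)"
    using assms norm_z_antimono[OF assms(1)]
    by (intro norm_integral_matrix_vector_mult_le continuous_on_z) auto
  then show ?thesis
    using z_diff_eq_integral[OF assms]
      norm_triangle_ineq4[of "integral {a..t} (\<lambda>s. A *v z s)" "integral {a..t} feedback"]
    by simp
qed

lemma norm_z_minus_exp_taylor_Suc_le: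
  assumes "0 \<le> a" "a \<le> t"
    and E: "\<And>s. s \<in> {a..t} \<Longrightarrow> norm (z s - exp_taylor A (z a) a k s) \<le> E"
  shows "norm (z t - exp_taylor A (z a) a (Suc k) t)
           \<le> onorm ((*v) A) * E * (t - a) + norm (integral {a..t} feedback)"
proof -
  have "norm (integral {a..t} (\<lambda>s. A *v (z s - exp_taylor A (z a) a k s)))
          \<le> onorm ((*v) A) * E * (t - a)"
    using E assms by (intro norm_integral_matrix_vector_mult_le continuous_on_diff continuous_on_z
        continuous_on_exp_taylor) auto
  then show ?thesis
    using z_minus_exp_taylor_Suc[OF assms(1,2), of k]
      norm_triangle_ineq4[of "integral {a..t} (\<lambda>s. A *v (z s - exp_taylor A (z a) a k s))"
        "integral {a..t} feedback"]
    by simp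
qed

text \<open>Picard iteration: each degree integrates the previous error against \<open>A\<close>.\<close>

lemma norm_z_minus_exp_taylor_le:
  assumes a: "0 \<le> a" "b - a \<le> 1"
    and J: "\<And>t. t \<in> {a..b} \<Longrightarrow> norm (integral {a..t} feedback) \<le> J"
    and t: "t \<in> {a..b}"
  shows "norm (z t - exp_taylor A (z a) a k t)
           \<le> taylor_error_const (onorm ((*v) A)) k * ((t - a)^(k + 1) * norm (z a) + J)"
  using t
proof (induction k arbitrary: t)
  case 0
  then have t: "a \<le> t" "t \<le> b"
    by auto
  have J0: "0 \<le> J"
    using J[OF "0.prems"] norm_ge_zero order.trans by blast
  have "norm (z t - z a) \<le> onorm ((*v) A) * norm (z a) * (t - a) + J"
    using norm_z_diff_le_feedback[OF a(1) t(1)] J[OF "0.prems"] by simp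
  moreover have "0 \<le> (t - a) * norm (z a)"
    using t by simp
  ultimately have "norm (z t - z a) \<le> (onorm ((*v) A) + 1) * ((t - a) * norm (z a) + J)"
    using mult_nonneg_nonneg[OF J0 onorm_matrix_vector_mult_nonneg[of A]]
    by (simp add: algebra_simps)
  then show ?case
    by simp
next
  case (Suc k)
  define nA C where "nA = onorm ((*v) A)" and "C = taylor_error_const nA k"
  define E where "E = C * ((t - a)^(k + 1) * norm (z a) + J)"
  have t: "a \<le> t" "t \<le> b"
    using Suc.prems by auto
  have nA: "0 \<le> nA"
    by (simp add: nA_def onorm_matrix_vector_mult_nonneg)
  then have C: "0 \<le> C"
    by (simp add: C_def taylor_error_const_nonneg)
  have J0: "0 \<le> J"
    using J[OF Suc.prems] norm_ge_zero order.trans by blast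
  have E_bound: "norm (z s - exp_taylor A (z a) a k s) \<le> E" if "s \<in> {a..t}" for s
  proof -
    have "(s - a)^(k + 1) * norm (z a) \<le> (t - a)^(k + 1) * norm (z a)"
      using that by (intro mult_right_mono power_mono) auto
    then have "C * ((s - a)^(k + 1) * norm (z a) + J) \<le> E"
      unfolding E_def using C by (intro mult_left_mono add_right_mono)
    moreover have "norm (z s - exp_taylor A (z a) a k s) \<le> C * ((s - a)^(k + 1) * norm (z a) + J)"
      using Suc.IH[of s] that t by (simp add: C_def nA_def)
    ultimately show ?thesis
      by linarith
  qed
  have "norm (z t - exp_taylor A (z a) a (Suc k) t) \<le> nA * E * (t - a) + J"
    using norm_z_minus_exp_taylor_Suc_le[OF a(1) t(1) E_bound] J[OF Suc.prems] by (simp add: nA_def)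
  also have "\<dots> \<le> (nA * C + 1) * ((t - a)^(Suc k + 1) * norm (z a) + J)"
  proof -
    define X where "X = (t - a)^(Suc k + 1) * norm (z a)"
    have "nA * E * (t - a) + J = nA * C * X + nA * C * J * (t - a) + J"
      by (simp add: E_def X_def algebra_simps)
    moreover have "(nA * C + 1) * (X + J) = nA * C * X + nA * C * J + X + J"
      by (simp add: algebra_simps)
    moreover have "nA * C * J * (t - a) \<le> nA * C * J"
      using t a nA C J0 by (intro mult_left_le) auto
    moreover have "0 \<le> X"
      using t by (simp add: X_def)
    ultimately show ?thesis
      unfolding X_def[symmetric] by linarith
  qed
  finally show ?case
    by (simp add: C_def nA_def)
qed

end

section \<open>The Kalman rank condition for skew-symmetric generators\<close>

lemma mpow_commute: "mpow A j ** A = A ** mpow A j"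
proof (induction j)
  case (Suc j)
  have "mpow A (Suc j) ** A = A ** (mpow A j ** A)"
    by (simp add: mpow_Suc matrix_mul_assoc)
  then show ?case
    using Suc by (simp add: mpow_Suc)
qed simp

lemma transpose_mpow_skew:
  fixes A :: "real^'n^'n"
  assumes skew: "transpose A = - A"
  shows "transpose (mpow A j) *v x = (-1)^j *\<^sub>R (mpow A j *v x)"
proof (induction j arbitrary: x)
  case (Suc j)
  have "transpose (mpow A (Suc j)) *v x = transpose (mpow A j) *v (transpose A *v x)"
    by (simp only: mpow_Suc matrix_transpose_mul matrix_vector_mul_assoc)
  also have "\<dots> = (-1)^j *\<^sub>R (mpow A j *v (- (A *v x)))"
    using skew Suc by (simp add: matrix_vector_mult_uminus)
  also have "mpow A j *v (- (A *v x)) = - (mpow A (Suc j) *v x)"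
    by (simp add: vec.neg matrix_vector_mul_assoc mpow_commute mpow_Suc)
  finally show ?case
    by simp
qed (simp add: transpose_mat)

lemma kalman_rank_kalman_index:
  fixes A :: "real^'n^'n" and B :: "real^'r^'n"
  shows "controllable A B \<Longrightarrow> kalman_rank A B (kalman_index A B) = CARD('n)"
  unfolding controllable_def kalman_index_def by (rule LeastI)

text \<open>By skew-symmetry the columns of \<open>A^j B\<close> are, up to sign, the rows of
  \<open>B\<^sup>T A^j\<close>; so a vector annihilated by all \<open>B\<^sup>T A^j\<close> is orthogonal to a spanning set.\<close>

lemma kalman_observability_injective:
  fixes A :: "real^'n^'n" and B :: "real^'r^'n"
  assumes skew: "transpose A = - A" and ctrl: "controllable A B"
    and zero: "\<And>j. j \<le> kalman_index A B \<Longrightarrow> transpose B *v (mpow A j *v x) = 0"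
  shows "x = 0"
proof -
  define S where "S = (\<Union>j\<in>{..kalman_index A B}. columns (mpow A j ** B))"
  have "dim S = DIM(real^'n)"
    using kalman_rank_kalman_index[OF ctrl] by (simp add: kalman_rank_def S_def)
  then have span: "span S = UNIV"
    by (simp only: dim_eq_full)
  have "orthogonal x y" if "y \<in> S" for y
  proof -
    obtain j i where j: "j \<le> kalman_index A B" and y: "y = column i (mpow A j ** B)"
      using \<open>y \<in> S\<close> unfolding S_def columns_def by blast
    have "y \<bullet> x = (transpose (mpow A j ** B) *v x) $ i"
      by (simp add: y column_def inner_vec_def matrix_vector_mult_def transpose_def mult.commute)
    also have "transpose (mpow A j ** B) *v x = (-1)^j *\<^sub>R (transpose B *v (mpow A j *v x))"
      by (simp only: matrix_transpose_mul matrix_vector_mul_assoc[symmetric]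
          transpose_mpow_skew[OF skew] matrix_vector_mult_scaleR)
    finally show ?thesis
      using zero[OF j] by (simp add: orthogonal_def inner_commute)
  qed
  then have "orthogonal x x"
    using orthogonal_to_span[of x S x] span by auto
  then show ?thesis
    by (simp add: orthogonal_def)
qed

definition observability_form :: "real^'n^'n \<Rightarrow> real^'r^'n \<Rightarrow> nat \<Rightarrow> real^'n \<Rightarrow> real" where
  "observability_form A B K x = (\<Sum>j\<le>K. (norm (transpose B *v (mpow A j *v x)))^2)"

lemma observability_form_scaleR:
  "observability_form A B K (c *\<^sub>R x) = c^2 * observability_form A B K x"
  by (simp add: observability_form_def matrix_vector_mult_scaleR sum_distrib_left power_mult_distrib)

lemma continuous_on_observability_form:
  fixes A :: "real^'n^'n" and B :: "real^'r^'n"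
  shows "continuous_on S (observability_form A B K)"
proof -
  have "continuous_on S (\<lambda>x. transpose B *v (mpow A j *v x))" for j
    using continuous_on_compose[OF
        linear_continuous_on[OF matrix_vector_mul_bounded_linear[of "mpow A j"]]
        linear_continuous_on[OF matrix_vector_mul_bounded_linear[of "transpose B"]]]
    by (simp add: o_def)
  then show ?thesis
    unfolding observability_form_def by (intro continuous_intros) auto
qed

text \<open>Coercivity follows from injectivity by compactness of the unit sphere.\<close>

lemma observability_form_coercive:
  fixes A :: "real^'n^'n" and B :: "real^'r^'n"
  assumes skew: "transpose A = - A" and ctrl: "controllable A B"
  shows "\<exists>m>0. \<forall>x. m * (norm x)^2 \<le> observability_form A B (kalman_index A B) x"
proof -
  define Q where "Q = observability_form A B (kalman_index A B)"
  have "sphere (0::real^'n) 1 \<noteq> {}"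
    by simp
  then obtain x0 where x0: "x0 \<in> sphere 0 1" and min: "\<And>y. y \<in> sphere 0 1 \<Longrightarrow> Q x0 \<le> Q y"
    using continuous_attains_inf[OF compact_sphere _ continuous_on_observability_form]
    unfolding Q_def by blast
  have "0 < Q x0"
  proof (rule ccontr)
    assume "\<not> 0 < Q x0"
    then have "(\<Sum>j\<le>kalman_index A B. (norm (transpose B *v (mpow A j *v x0)))^2) = 0"
      using sum_nonneg[of "{..kalman_index A B}" "\<lambda>j. (norm (transpose B *v (mpow A j *v x0)))^2"]
      unfolding Q_def observability_form_def by simp
    then have "\<forall>j\<in>{..kalman_index A B}. (norm (transpose B *v (mpow A j *v x0)))^2 = 0"
      by (subst (asm) sum_nonneg_eq_0_iff) auto
    then have "x0 = 0"
      by (intro kalman_observability_injective[OF skew ctrl]) auto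
    then show False
      using x0 by simp
  qed
  moreover have "Q x0 * (norm x)^2 \<le> Q x" for x
  proof (cases "x = 0")
    case False
    define y where "y = (1 / norm x) *\<^sub>R x"
    have "y \<in> sphere 0 1" "x = norm x *\<^sub>R y"
      using False by (simp_all add: y_def)
    then have "Q x = (norm x)^2 * Q y"
      by (metis Q_def observability_form_scaleR)
    then show ?thesis
      using mult_right_mono[OF min[OF \<open>y \<in> sphere 0 1\<close>] zero_le_power2[of "norm x"]]
      by (simp add: mult.commute)
  qed (simp add: Q_def observability_form_def)
  ultimately show ?thesis
    unfolding Q_def by blast
qed

lemma exists_ge_average:
  fixes f :: "'a \<Rightarrow> real"
  assumes "finite S" "S \<noteq> {}" "c \<le> sum f S"
  shows "\<exists>i\<in>S. c / real (card S) \<le> f i"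
proof (rule ccontr)
  assume "\<not> ?thesis"
  then have "sum f S < sum (\<lambda>_. c / real (card S)) S"
    using assms by (intro sum_strict_mono) auto
  then show False
    using assms by simp
qed

lemma exists_large_observed_component:
  fixes A :: "real^'n^'n" and B :: "real^'r^'n"
  assumes skew: "transpose A = - A" and ctrl: "controllable A B"
  shows "\<exists>\<kappa>>0. \<forall>x. \<exists>j\<le>kalman_index A B. \<exists>k.
           \<kappa> * (norm x)^2 \<le> ((transpose B *v (mpow A j *v x)) $ k)^2"
proof -
  define K where "K = kalman_index A B"
  obtain m where m: "m > 0" "\<And>x. m * (norm x)^2 \<le> observability_form A B K x"
    using observability_form_coercive[OF skew ctrl] unfolding K_def by blast
  have "\<exists>j\<le>K. \<exists>k. m / (real (K + 1) * real CARD('r)) * (norm x)^2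
                     \<le> ((transpose B *v (mpow A j *v x)) $ k)^2" for x
  proof -
    define v where "v j = transpose B *v (mpow A j *v x)" for j
    have "observability_form A B K x = (\<Sum>j\<le>K. \<Sum>k\<in>UNIV. (v j $ k)^2)"
      unfolding observability_form_def v_def[symmetric]
      by (simp only: power2_norm_eq_inner inner_vec_def) (simp add: power2_eq_square)
    also have "\<dots> = (\<Sum>(j, k)\<in>{..K} \<times> UNIV. (v j $ k)^2)"
      by (rule sum.cartesian_product)
    finally obtain j k where "j \<le> K"
      and "m * (norm x)^2 / real (card ({..K} \<times> (UNIV :: 'r set))) \<le> (v j $ k)^2"
      using exists_ge_average[of "{..K} \<times> (UNIV :: 'r set)" "m * (norm x)^2" "\<lambda>(j, k). (v j $ k)^2"]
        m(2)[of x] by auto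
    then show ?thesis
      by (intro exI[of _ j] conjI exI[of _ k]) (auto simp: v_def card_cartesian_product algebra_simps)
  qed
  then show ?thesis
    using m(1) by (intro exI[of _ "m / (real (K + 1) * real CARD('r))"]) (auto simp: K_def)
qed

text \<open>The \<open>k\<close>-th output component of the Taylor polynomial \<open>exp_taylor\<close>, as a polynomial in
  \<open>t - a\<close>.\<close>

definition observed_taylor_poly :: "real^'n^'n \<Rightarrow> real^'r^'n \<Rightarrow> real^'n \<Rightarrow> 'r \<Rightarrow> nat \<Rightarrow> real poly" where
  "observed_taylor_poly A B x k K = (\<Sum>j\<le>K. monom ((transpose B *v (mpow A j *v x)) $ k / fact j) j)"

lemma degree_observed_taylor_poly: "degree (observed_taylor_poly A B x k K) \<le> K"
  unfolding observed_taylor_poly_def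
  by (rule degree_sum_le) (auto intro: order.trans[OF degree_monom_le])

lemma coeff_observed_taylor_poly:
  "j \<le> K \<Longrightarrow> coeff (observed_taylor_poly A B x k K) j = (transpose B *v (mpow A j *v x)) $ k / fact j"
  unfolding observed_taylor_poly_def by (simp add: coeff_sum coeff_monom)

lemma poly_observed_taylor_poly:
  "poly (observed_taylor_poly A B x k K) (s - a) = (transpose B *v exp_taylor A x a K s) $ k"
  unfolding observed_taylor_poly_def exp_taylor_def
  by (simp add: poly_sum poly_monom vec.sum matrix_vector_mult_scaleR mult.commute)

lemma exists_large_observed_taylor_coeff:
  fixes A :: "real^'n^'n" and B :: "real^'r^'n"
  assumes skew: "transpose A = - A" and ctrl: "controllable A B"
  shows "\<exists>\<kappa>>0. \<forall>x. \<exists>k. \<exists>j\<le>kalman_index A B.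
           \<kappa> * (norm x)^2 \<le> (coeff (observed_taylor_poly A B x k (kalman_index A B)) j)^2"
proof -
  define K where "K = kalman_index A B"
  obtain \<kappa> where \<kappa>: "\<kappa> > 0"
    and large: "\<And>x. \<exists>j\<le>K. \<exists>k. \<kappa> * (norm x)^2 \<le> ((transpose B *v (mpow A j *v x)) $ k)^2"
    using exists_large_observed_component[OF skew ctrl] unfolding K_def by blast
  have "\<exists>k. \<exists>j\<le>K. \<kappa> / (fact K)^2 * (norm x)^2 \<le> (coeff (observed_taylor_poly A B x k K) j)^2" for x
  proof -
    obtain j k where j: "j \<le> K" and jk: "\<kappa> * (norm x)^2 \<le> ((transpose B *v (mpow A j *v x)) $ k)^2"
      using large by blast
    have "fact j \<le> (fact K :: real)"
      using j by (rule fact_mono)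
    then have "\<kappa> / (fact K)^2 * (norm x)^2 \<le> \<kappa> / (fact j)^2 * (norm x)^2"
      using \<kappa> by (intro mult_right_mono divide_left_mono power_mono) auto
    also have "\<dots> \<le> ((transpose B *v (mpow A j *v x)) $ k)^2 / (fact j)^2"
      using jk by (simp add: divide_right_mono)
    also have "\<dots> = (coeff (observed_taylor_poly A B x k K) j)^2"
      using j by (simp add: coeff_observed_taylor_poly power_divide)
    finally show ?thesis
      using j by blast
  qed
  then show ?thesis
    using \<kappa> unfolding K_def by (intro exI[of _ "\<kappa> / (fact (kalman_index A B))^2"]) auto
qed

context damped_skew_system
begin

lemma set_integrable_damping: "set_integrable lborel {u..v} damping"
  using set_integrable_bounded_Icc[OF damping_measurable, of u v 1] damping_range by auto

lemma integrable_damping: "damping integrable_on {u..v}"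
  using set_integrable_damping set_borel_integral_eq_integral(1) by blast

lemma set_integral_damping_eq: "(LINT s:{u..v}|lborel. damping s) = integral {u..v} damping"
  by (rule set_borel_integral_eq_integral(2)[OF set_integrable_damping])

lemma integral_damping_le: "u \<le> v \<Longrightarrow> integral {u..v} damping \<le> v - u"
  using integral_le[OF integrable_damping integrable_const_ivl, of u v 1] damping_range by simp

text \<open>By the inequality of arithmetic and geometric means,
  \<open>\<alpha> |B\<^sup>T z| \<le> (\<epsilon> \<alpha> + \<alpha> |B\<^sup>T z|\<^sup>2 / \<epsilon>) / 2\<close>.\<close>

lemma norm_feedback_le:
  assumes "0 \<le> s" and \<epsilon>: "0 < \<epsilon>"
  shows "norm (feedback s) \<le> onorm ((*v) B) * ((\<epsilon> * damping s + dissipation s / \<epsilon>) / 2)"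
proof -
  have "0 \<le> damping s * (\<epsilon> - norm (observed s))^2 / \<epsilon>"
    using damping_range[of s] \<epsilon> by simp
  also have "\<dots> = \<epsilon> * damping s + dissipation s / \<epsilon> - 2 * (damping s * norm (observed s))"
    using \<epsilon> by (simp add: dissipation_def power2_eq_square field_simps)
  finally have am_gm: "damping s * norm (observed s) \<le> (\<epsilon> * damping s + dissipation s / \<epsilon>) / 2"
    by simp
  have "norm (feedback s) = damping s * norm (B *v observed s)"
    using damping_range[of s] \<open>0 \<le> s\<close>
    by (simp add: feedback_def damping_eq observed_def matrix_vector_mul_assoc[symmetric])
  also have "\<dots> \<le> damping s * (onorm ((*v) B) * norm (observed s))"
    using damping_range[of s] norm_matrix_vector_mult_le[of B "observed s"]
    by (intro mult_left_mono) auto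
  also have "\<dots> = onorm ((*v) B) * (damping s * norm (observed s))"
    by simp
  also have "\<dots> \<le> onorm ((*v) B) * ((\<epsilon> * damping s + dissipation s / \<epsilon>) / 2)"
    using am_gm onorm_matrix_vector_mult_nonneg by (rule mult_left_mono)
  finally show ?thesis .
qed

lemma norm_integral_feedback_le:
  assumes a: "0 \<le> a" "a \<le> t" "t \<le> b" and \<epsilon>: "0 < \<epsilon>"
  shows "norm (integral {a..t} feedback)
           \<le> onorm ((*v) B) * (\<epsilon> * (b - a) + integral {a..b} dissipation / \<epsilon>) / 2"
proof -
  define nB where "nB = onorm ((*v) B)"
  have nB: "0 \<le> nB"
    by (simp add: nB_def onorm_matrix_vector_mult_nonneg)
  define G where "G s = (nB * \<epsilon> / 2) *\<^sub>R damping s + (nB / (2 * \<epsilon>)) *\<^sub>R dissipation s" for s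
  have G_int: "G integrable_on {u..v}" if "0 \<le> u" for u v
    unfolding G_def using integrable_damping integrable_dissipation[OF that]
    by (intro integrable_cmul integrable_add) auto
  have G_nonneg: "0 \<le> G s" for s
    using damping_range[of s] dissipation_nonneg[of s] nB \<epsilon> by (simp add: G_def)
  have "norm (integral {a..t} feedback) \<le> integral {a..t} G"
  proof (rule integral_norm_bound_integral[OF _ G_int[OF a(1)]])
    show "feedback integrable_on {a..t}"
      using has_integral_feedback[OF a(1,2)] by blast
    show "norm (feedback s) \<le> G s" if "s \<in> {a..t}" for s
      using norm_feedback_le[of s \<epsilon>] that a \<epsilon> by (simp add: G_def nB_def field_simps)
  qed
  also have "\<dots> \<le> integral {a..b} G"
    using a G_int[OF a(1)] G_nonneg by (intro integral_subset_le) auto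
  also have "\<dots> = nB * (\<epsilon> * integral {a..b} damping + integral {a..b} dissipation / \<epsilon>) / 2"
  proof -
    have "(\<lambda>s. (nB * \<epsilon> / 2) *\<^sub>R damping s) integrable_on {a..b}"
      by (rule integrable_cmul[OF integrable_damping])
    moreover have "(\<lambda>s. (nB / (2 * \<epsilon>)) *\<^sub>R dissipation s) integrable_on {a..b}"
      by (rule integrable_cmul[OF integrable_dissipation[OF a(1)]])
    ultimately show ?thesis
      using \<epsilon> unfolding G_def by (simp only: integral_add integral_cmul) (simp add: field_simps)
  qed
  also have "\<dots> \<le> nB * (\<epsilon> * (b - a) + integral {a..b} dissipation / \<epsilon>) / 2"
    using integral_damping_le[of a b] a \<epsilon> nB
    by (intro divide_right_mono mult_left_mono add_right_mono) auto
  finally show ?thesis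
    by (simp add: nB_def)
qed

definition "taylor_gap_const K =
  onorm ((*v) (transpose B)) * taylor_error_const (onorm ((*v) A)) K * (1 + onorm ((*v) B))"

text \<open>When the dissipation on \<open>[a, a + L]\<close> is at most \<open>L^(2K+1) |z a|\<^sup>2\<close>, the choice
  \<open>\<epsilon> = L^K |z a|\<close> balances the two terms of \<open>norm_integral_feedback_le\<close>.\<close>

lemma norm_integral_feedback_le_small_dissipation:
  assumes a: "0 \<le> a" and L: "0 < L" and x: "0 < norm (z a)"
    and D: "integral {a..a + L} dissipation \<le> L^(2 * K + 1) * (norm (z a))^2"
    and t: "t \<in> {a..a + L}"
  shows "norm (integral {a..t} feedback) \<le> onorm ((*v) B) * (L^(K + 1) * norm (z a))"
proof -
  define \<epsilon> where "\<epsilon> = L^K * norm (z a)"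
  have \<epsilon>: "0 < \<epsilon>"
    using L x by (simp add: \<epsilon>_def)
  have "L^(2 * K + 1) = L^K * L^(K + 1)"
    unfolding power_add[symmetric] by (simp add: mult_2)
  then have eq: "\<epsilon> * (L^(K + 1) * norm (z a)) = L^(2 * K + 1) * (norm (z a))^2"
    unfolding \<epsilon>_def power2_eq_square by (simp only: mult_ac)
  have "integral {a..a + L} dissipation \<le> \<epsilon> * (L^(K + 1) * norm (z a))"
    by (subst eq) (rule D)
  then have "integral {a..a + L} dissipation / \<epsilon> \<le> L^(K + 1) * norm (z a)"
    using \<epsilon> by (simp add: divide_le_eq mult.commute)
  moreover have "\<epsilon> * L = L^(K + 1) * norm (z a)"
    by (simp add: \<epsilon>_def mult_ac)
  moreover have "(u + v) / 2 \<le> w" if "v \<le> w" "u = w" for u v w :: real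
    using that by simp
  ultimately have "(\<epsilon> * L + integral {a..a + L} dissipation / \<epsilon>) / 2 \<le> L^(K + 1) * norm (z a)"
    by blast
  then have "onorm ((*v) B) * ((\<epsilon> * L + integral {a..a + L} dissipation / \<epsilon>) / 2)
               \<le> onorm ((*v) B) * (L^(K + 1) * norm (z a))"
    using onorm_matrix_vector_mult_nonneg[of B] by (rule mult_left_mono)
  then show ?thesis
    using norm_integral_feedback_le[OF a _ _ \<epsilon>, of t "a + L"] t by simp
qed

lemma norm_observed_minus_taylor_le:
  assumes a: "0 \<le> a" and L: "0 < L" "L \<le> 1" and x: "0 < norm (z a)"
    and D: "integral {a..a + L} dissipation \<le> L^(2 * K + 1) * (norm (z a))^2"
    and s: "s \<in> {a..a + L}"
  shows "norm (observed s - transpose B *v exp_taylor A (z a) a K s)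
           \<le> taylor_gap_const K * L^(K + 1) * norm (z a)"
proof -
  define nB C where "nB = onorm ((*v) B)" and "C = taylor_error_const (onorm ((*v) A)) K"
  define J where "J = nB * (L^(K + 1) * norm (z a))"
  have C: "0 \<le> C"
    by (simp add: C_def taylor_error_const_nonneg onorm_matrix_vector_mult_nonneg)
  have J: "norm (integral {a..t} feedback) \<le> J" if "t \<in> {a..a + L}" for t
    unfolding J_def nB_def using a L(1) x D that by (rule norm_integral_feedback_le_small_dissipation)
  have "norm (z s - exp_taylor A (z a) a K s) \<le> C * ((s - a)^(K + 1) * norm (z a) + J)"
    using norm_z_minus_exp_taylor_le[OF a _ J s] L by (simp add: C_def)
  also have "\<dots> \<le> C * (L^(K + 1) * norm (z a) + J)"
    using s C by (intro mult_left_mono add_right_mono mult_right_mono power_mono) auto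
  also have "\<dots> = C * (1 + nB) * (L^(K + 1) * norm (z a))"
    by (simp add: J_def algebra_simps)
  finally have "onorm ((*v) (transpose B)) * norm (z s - exp_taylor A (z a) a K s)
      \<le> onorm ((*v) (transpose B)) * (C * (1 + nB) * (L^(K + 1) * norm (z a)))"
    by (simp add: mult_left_mono onorm_matrix_vector_mult_nonneg)
  moreover have "observed s - transpose B *v exp_taylor A (z a) a K s
                   = transpose B *v (z s - exp_taylor A (z a) a K s)"
    by (simp add: observed_def matrix_vector_mult_diff_distrib)
  ultimately show ?thesis
    using norm_matrix_vector_mult_le[of "transpose B" "z s - exp_taylor A (z a) a K s"]
    by (simp add: taylor_gap_const_def C_def nB_def mult_ac)
qed

lemma integral_damping_observed_taylor_le:
  assumes a: "0 \<le> a" and L: "0 < L" "L \<le> 1" and x: "0 < norm (z a)"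
    and D: "integral {a..a + L} dissipation \<le> L^(2 * K + 1) * (norm (z a))^2"
  shows "(LINT s:{a..a + L}|lborel. damping s * (poly (observed_taylor_poly A B (z a) k K) (s - a))^2)
           \<le> 2 * integral {a..a + L} dissipation
              + 2 * (taylor_gap_const K)^2 * L^2 * (L^(2 * K + 1) * (norm (z a))^2)"
proof -
  define p where "p = observed_taylor_poly A B (z a) k K"
  define E where "E = taylor_gap_const K * L^(K + 1) * norm (z a)"
  have pointwise: "damping s * (poly p (s - a))^2 \<le> 2 * dissipation s + 2 * E^2"
    if s: "s \<in> {a..a + L}" for s
  proof -
    define q where "q = transpose B *v exp_taylor A (z a) a K s"
    have "\<bar>poly p (s - a)\<bar> \<le> norm q"
      unfolding p_def poly_observed_taylor_poly q_def by (rule component_le_norm_cart)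
    also have "\<dots> \<le> norm (observed s) + norm (observed s - q)"
      by (metis norm_triangle_sub add.commute norm_minus_commute)
    also have "\<dots> \<le> norm (observed s) + E"
      using norm_observed_minus_taylor_le[OF a L x D s] by (simp add: q_def E_def)
    finally have "(poly p (s - a))^2 \<le> (norm (observed s) + E)^2"
      by (metis abs_ge_zero power2_abs power_mono)
    also have "\<dots> \<le> 2 * (norm (observed s))^2 + 2 * E^2"
      using zero_le_power2[of "norm (observed s) - E"] by (simp add: power2_eq_square algebra_simps)
    finally have "damping s * (poly p (s - a))^2 \<le> damping s * (2 * (norm (observed s))^2 + 2 * E^2)"
      using damping_range[of s] by (simp add: mult_left_mono)
    also have "\<dots> \<le> 2 * dissipation s + 2 * E^2"
      using damping_range[of s] by (simp add: dissipation_def algebra_simps mult_left_le_one_le)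
    finally show ?thesis .
  qed
  have int_dis: "set_integrable lborel {a..a + L} dissipation"
    using set_integrable_dissipation[OF a] .
  have int_const: "set_integrable lborel {a..a + L} (\<lambda>s. 2 * E^2)"
    by (rule set_integrable_bounded_Icc[where C = "2 * E^2"]) auto
  have "(LINT s:{a..a + L}|lborel. damping s * (poly p (s - a))^2)
          \<le> (LINT s:{a..a + L}|lborel. 2 * dissipation s + 2 * E^2)"
  proof (rule set_integral_mono)
    show "set_integrable lborel {a..a + L} (\<lambda>s. damping s * (poly p (s - a))^2)"
      using damping_measurable damping_range
      by (intro set_integrable_mult_continuous_on continuous_intros) auto
    show "set_integrable lborel {a..a + L} (\<lambda>s. 2 * dissipation s + 2 * E^2)"
      using int_dis int_const by (intro set_integral_add set_integrable_mult_right) auto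
  qed (rule pointwise)
  also have "\<dots> = 2 * integral {a..a + L} dissipation + 2 * E^2 * L"
    using int_dis int_const L
    by (simp add: set_integral_add set_integral_const set_borel_integral_eq_integral(2))
  also have "2 * E^2 * L = 2 * (taylor_gap_const K)^2 * L^2 * (L^(2 * K + 1) * (norm (z a))^2)"
  proof -
    have "L^(K * 2) = L^K * L^K"
      by (simp add: power_mult power2_eq_square)
    then show ?thesis
      by (simp add: E_def power_mult_distrib power2_eq_square power_add mult_ac)
  qed
  finally show ?thesis
    by (simp add: p_def)
qed

lemma observability_le_dissipation:
  assumes \<rho>: "0 < \<rho>" and a: "0 \<le> a" and L: "0 < L" "L \<le> 1"
    and mass: "\<rho> * L \<le> integral {a..a + L} damping"
    and D: "integral {a..a + L} dissipation \<le> L^(2 * K + 1) * (norm (z a))^2"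
    and x: "0 < norm (z a)"
    and \<kappa>: "0 < \<kappa>" "\<kappa> * (norm (z a))^2 \<le> (coeff (observed_taylor_poly A B (z a) k K) j)^2"
  shows "poly_obs_const K \<rho> * \<kappa> * (L^(2 * K + 1) * (norm (z a))^2)
           \<le> 2 * integral {a..a + L} dissipation
              + 2 * (taylor_gap_const K)^2 * L^2 * (L^(2 * K + 1) * (norm (z a))^2)"
proof -
  define p where "p = observed_taylor_poly A B (z a) k K"
  define \<gamma> where "\<gamma> = sqrt \<kappa> * norm (z a)"
  have "\<gamma> = sqrt (\<kappa> * (norm (z a))^2)"
    using \<kappa> by (simp add: \<gamma>_def real_sqrt_mult)
  also have "\<dots> \<le> \<bar>coeff p j\<bar>"
    using real_sqrt_le_mono[OF \<kappa>(2)] by (simp add: p_def)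
  finally have \<gamma>_le: "\<gamma> \<le> \<bar>coeff p j\<bar>" .
  have "poly_obs_const K \<rho> * \<kappa> * (L^(2 * K + 1) * (norm (z a))^2)
          = poly_obs_const K \<rho> * \<gamma>^2 * L^(2 * K + 1)"
    using \<kappa> by (simp add: \<gamma>_def power_mult_distrib)
  also have "\<dots> \<le> (LINT s:{a..a + L}|lborel. damping s * (poly p (s - a))^2)"
    using mass \<gamma>_le \<kappa> x
    by (intro poly_observability[OF damping_measurable damping_range \<rho> L _ degree_observed_taylor_poly[of A B "z a" k K, folded p_def]])
      (auto simp: set_integral_damping_eq \<gamma>_def)
  also have "\<dots> \<le> 2 * integral {a..a + L} dissipation
                  + 2 * (taylor_gap_const K)^2 * L^2 * (L^(2 * K + 1) * (norm (z a))^2)"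
    unfolding p_def by (rule integral_damping_observed_taylor_le[OF a L x D])
  finally show ?thesis .
qed

text \<open>Either the dissipation on \<open>[a, a + L]\<close> already exceeds \<open>L^(2K+1) |z a|\<^sup>2\<close>, or
  the output follows the Taylor polynomial and \<open>observability_le_dissipation\<close> applies;
  the hypothesis on \<open>L\<close> makes its error term absorbable.\<close>

lemma integral_dissipation_ge:
  assumes \<rho>: "0 < \<rho>" and a: "0 \<le> a" and L: "0 < L" "L \<le> 1"
    and mass: "\<rho> * L \<le> integral {a..a + L} damping"
    and \<kappa>: "0 < \<kappa>" "\<And>x. \<exists>k. \<exists>j\<le>K. \<kappa> * (norm x)^2 \<le> (coeff (observed_taylor_poly A B x k K) j)^2"
    and gap: "(taylor_gap_const K)^2 * L^2 \<le> poly_obs_const K \<rho> * \<kappa> / 4"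
  shows "min 1 (poly_obs_const K \<rho> * \<kappa> / 4) * (L^(2 * K + 1) * (norm (z a))^2)
           \<le> integral {a..a + L} dissipation"
proof -
  define c1 D P where "c1 = poly_obs_const K \<rho> * \<kappa>" and "D = integral {a..a + L} dissipation"
    and "P = L^(2 * K + 1) * (norm (z a))^2"
  have "0 \<le> P"
    using L by (simp add: P_def)
  show ?thesis
  proof (cases "P \<le> D")
    case True
    have "min 1 (c1 / 4) * P \<le> 1 * P"
      using \<open>0 \<le> P\<close> by (intro mult_right_mono) auto
    then show ?thesis
      using True by (simp add: c1_def D_def P_def)
  next
    case False
    then have x: "0 < norm (z a)"
      using integral_nonneg[OF integrable_dissipation[OF a] dissipation_nonneg]
      by (auto simp: P_def D_def)
    obtain k j where "\<kappa> * (norm (z a))^2 \<le> (coeff (observed_taylor_poly A B (z a) k K) j)^2"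
      using \<kappa>(2) by blast
    then have "c1 * P \<le> 2 * D + 2 * ((taylor_gap_const K)^2 * L^2) * P"
      using observability_le_dissipation[OF \<rho> a L mass _ x \<kappa>(1)] False
      by (simp add: c1_def D_def P_def mult.assoc)
    moreover have "(taylor_gap_const K)^2 * L^2 * P \<le> c1 / 4 * P"
      using gap \<open>0 \<le> P\<close> by (intro mult_right_mono) (auto simp: c1_def)
    ultimately have "c1 / 4 * P \<le> D"
      by linarith
    moreover have "min 1 (c1 / 4) * P \<le> c1 / 4 * P"
      using \<open>0 \<le> P\<close> by (intro mult_right_mono) auto
    ultimately show ?thesis
      by (simp add: c1_def D_def P_def)
  qed
qed

lemma local_energy_decay:
  assumes ctrl: "controllable A B" and \<rho>: "0 < \<rho>"
  obtains c L0 where "0 < c" "0 < L0"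
    "\<And>a L. 0 \<le> a \<Longrightarrow> 0 < L \<Longrightarrow> L \<le> L0 \<Longrightarrow> \<rho> * L \<le> integral {a..a + L} damping \<Longrightarrow>
       c * L^(2 * kalman_index A B + 1) * energy a \<le> energy a - energy (a + L)"
proof -
  define K where "K = kalman_index A B"
  obtain \<kappa> where \<kappa>: "0 < \<kappa>"
    and large: "\<And>x. \<exists>k. \<exists>j\<le>K. \<kappa> * (norm x)^2 \<le> (coeff (observed_taylor_poly A B x k K) j)^2"
    using exists_large_observed_taylor_coeff[OF skew ctrl] unfolding K_def by blast
  define c1 C2 where "c1 = poly_obs_const K \<rho> * \<kappa>" and "C2 = taylor_gap_const K"
  have c1: "0 < c1"
    using poly_obs_const_pos[OF \<rho>] \<kappa> by (simp add: c1_def)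
  have C2: "0 < 4 * C2^2 + 1"
    by (simp add: add_nonneg_pos)
  show ?thesis
  proof (rule that[of "min 1 (c1 / 4)" "min 1 (c1 / (4 * C2^2 + 1))"])
    show "0 < min 1 (c1 / 4)" "0 < min 1 (c1 / (4 * C2^2 + 1))"
      using c1 C2 by simp_all
    fix a L
    assume a: "0 \<le> a" and L: "0 < L" "L \<le> min 1 (c1 / (4 * C2^2 + 1))"
      and mass: "\<rho> * L \<le> integral {a..a + L} damping"
    have "L^2 \<le> c1 / (4 * C2^2 + 1)"
      using L by (auto simp: power2_eq_square intro: order.trans[OF mult_left_le_one_le])
    then have "C2^2 * L^2 \<le> C2^2 * (c1 / (4 * C2^2 + 1))"
      by (rule mult_left_mono) simp
    also have "\<dots> \<le> c1 / 4"
      using c1 C2 by (simp add: field_simps)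
    finally have "min 1 (c1 / 4) * (L^(2 * K + 1) * (norm (z a))^2) \<le> integral {a..a + L} dissipation"
      using integral_dissipation_ge[OF \<rho> a L(1) _ mass \<kappa> large] L by (simp add: c1_def C2_def)
    moreover have "0 \<le> integral {a..a + L} dissipation"
      using integral_nonneg[OF integrable_dissipation[OF a] dissipation_nonneg] .
    ultimately show "min 1 (c1 / 4) * L^(2 * kalman_index A B + 1) * energy a \<le> energy a - energy (a + L)"
      using energy_identity[OF a, of "a + L"] L by (simp add: K_def energy_def mult.assoc)
  qed
qed

end

section \<open>Summing the decay over the intervals\<close>

lemma integral_split_equal_pieces:
  fixes \<beta> :: "real \<Rightarrow> real"
  assumes int: "\<And>u v. \<beta> integrable_on {u..v}" and h: "0 \<le> h"
  shows "integral {a..a + real k * h} \<beta> = (\<Sum>i<k. integral {a + real i * h..a + real (Suc i) * h} \<beta>)"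
proof (induction k)
  case (Suc k)
  have "integral {a..a + real k * h} \<beta> + integral {a + real k * h..a + real (Suc k) * h} \<beta>
          = integral {a..a + real (Suc k) * h} \<beta>"
    using h int by (intro Henstock_Kurzweil_Integration.integral_combine) (auto simp: distrib_right)
  then show ?case
    using Suc by simp
qed simp

text \<open>Cut \<open>[a, b]\<close> into pieces of equal length between \<open>L0 / 2\<close> and \<open>L0\<close>; one of them
  carries at least its share of the mass.\<close>

lemma exists_subinterval_with_mass:
  fixes \<beta> :: "real \<Rightarrow> real"
  assumes int: "\<And>u v. \<beta> integrable_on {u..v}" and L0: "0 < L0" "L0 < b - a"
    and mass: "\<rho> * (b - a) \<le> integral {a..b} \<beta>"
  obtains a' h where "a \<le> a'" "a' + h \<le> b" "L0 / 2 \<le> h" "h \<le> L0"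
    "\<rho> * h \<le> integral {a'..a' + h} \<beta>"
proof -
  define m where "m = nat \<lceil>(b - a) / L0\<rceil>"
  define h where "h = (b - a) / real m"
  have m: "(b - a) / L0 \<le> real m" "real m < (b - a) / L0 + 1" "1 < (b - a) / L0"
    using L0 ceiling_correct[of "(b - a) / L0"] by (auto simp: m_def)
  then have "0 < m"
    by linarith
  have h: "0 < h" "h \<le> L0" "L0 / 2 \<le> h"
    using m L0 \<open>0 < m\<close> by (auto simp: h_def field_simps)
  have b: "a + real m * h = b"
    using \<open>0 < m\<close> by (simp add: h_def)
  have "\<exists>i<m. \<rho> * h \<le> integral {a + real i * h..a + real (Suc i) * h} \<beta>"
  proof (rule ccontr)
    assume "\<not> ?thesis"
    then have "(\<Sum>i<m. integral {a + real i * h..a + real (Suc i) * h} \<beta>) < (\<Sum>i<m. \<rho> * h)"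
      using \<open>0 < m\<close> by (intro sum_strict_mono) auto
    then show False
      using mass integral_split_equal_pieces[OF int, of h a m] b h \<open>0 < m\<close>
      by (simp add: h_def)
  qed
  then obtain i where i: "i < m" "\<rho> * h \<le> integral {a + real i * h..a + real (Suc i) * h} \<beta>"
    by blast
  show ?thesis
  proof (rule that[of "a + real i * h" h])
    have "real (Suc i) * h \<le> real m * h"
      using i h by (intro mult_right_mono) auto
    then show "a + real i * h + h \<le> b"
      using b by (simp add: distrib_right)
    show "\<rho> * h \<le> integral {a + real i * h..a + real i * h + h} \<beta>"
      using i by (simp add: distrib_right add_ac)
  qed (use h in auto)
qed

lemma sum_drops_le_of_disjoint_intervals:
  fixes a b :: "nat \<Rightarrow> real" and F :: "real \<Rightarrow> real"
  assumes mono: "\<And>s t. 0 \<le> s \<Longrightarrow> s \<le> t \<Longrightarrow> F t \<le> F s"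
    and fin: "finite S"
    and ivs: "\<And>n. n \<in> S \<Longrightarrow> c \<le> a n \<and> a n < b n \<and> b n \<le> d"
    and disj: "\<And>m n. m \<in> S \<Longrightarrow> n \<in> S \<Longrightarrow> m \<noteq> n \<Longrightarrow> b m \<le> a n \<or> b n \<le> a m"
    and cd: "0 \<le> c" "c \<le> d"
  shows "(\<Sum>n\<in>S. F (a n) - F (b n)) \<le> F c - F d"
  using fin ivs disj cd(2)
proof (induction "card S" arbitrary: S d rule: less_induct)
  case less
  show ?case
  proof (cases "S = {}")
    case True
    then show ?thesis
      using mono cd less.prems by simp
  next
    case False
    txt \<open>Remove the rightmost interval and apply the induction hypothesis left of it.\<close>
    obtain n0 where n0: "n0 \<in> S" and rightmost: "\<And>m. m \<in> S \<Longrightarrow> b m \<le> b n0"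
      using Max_in[of "b ` S"] Max_ge[of "b ` S"] less.prems(1) False
      by (metis (no_types, lifting) finite_imageI image_iff image_is_empty)
    have left: "b m \<le> a n0" if "m \<in> S - {n0}" for m
    proof -
      have m: "m \<in> S" "m \<noteq> n0"
        using that by auto
      have "\<not> b n0 \<le> a m"
        using rightmost[OF m(1)] less.prems(2)[OF m(1)] by linarith
      then show ?thesis
        using less.prems(3)[OF m(1) n0 m(2)] by blast
    qed
    have "(\<Sum>n\<in>S - {n0}. F (a n) - F (b n)) \<le> F c - F (a n0)"
    proof (rule less.hyps)
      show "card (S - {n0}) < card S"
        by (rule card_Diff1_less[OF less.prems(1) n0])
      show "c \<le> a n \<and> a n < b n \<and> b n \<le> a n0" if "n \<in> S - {n0}" for n
        using less.prems(2)[of n] left[OF that] that by auto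
    qed (use less.prems n0 in auto)
    moreover have "F (a n0) - F (b n0) \<le> F (a n0) - F d"
      using mono[of "b n0" d] less.prems(2)[OF n0] cd by simp
    ultimately show ?thesis
      using sum.remove[OF less.prems(1) n0, of "\<lambda>n. F (a n) - F (b n)"] by simp
  qed
qed

lemma disjoint_greaterThanLessThan_imp_le:
  fixes a b c d :: real
  assumes "a < b" "c < d" "{a<..<b} \<inter> {c<..<d} = {}"
  shows "b \<le> c \<or> d \<le> a"
proof (rule ccontr)
  assume "\<not> ?thesis"
  then have "(max a c + min b d) / 2 \<in> {a<..<b} \<inter> {c<..<d}"
    using assms by auto
  then show False
    using assms by auto
qed

lemma summable_of_summable_min_pow:
  fixes d :: "nat \<Rightarrow> real"
  assumes "summable (\<lambda>n. (min (d n) r)^k)" "0 < r" "0 < k"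
  shows "summable (\<lambda>n. (d n)^k)"
proof -
  have "(\<lambda>n. (min (d n) r)^k) \<longlonglongrightarrow> 0"
    using assms(1) by (rule summable_LIMSEQ_zero)
  then have "\<forall>\<^sub>F n in sequentially. (min (d n) r)^k < r^k"
    using assms(2) by (intro order_tendstoD(2)) auto
  then have "\<forall>\<^sub>F n in sequentially. (min (d n) r)^k = (d n)^k"
    by eventually_elim (metis min.absorb3 min_def nle_le order_less_irrefl)
  then have "summable (\<lambda>n. (min (d n) r)^k) = summable (\<lambda>n. (d n)^k)"
    by (rule summable_cong)
  then show ?thesis
    using assms(1) by simp
qed

lemma antimono_tendsto_Inf:
  fixes f :: "real \<Rightarrow> real"
  assumes mono: "\<And>s t. 0 \<le> s \<Longrightarrow> s \<le> t \<Longrightarrow> f t \<le> f s" and bdd: "\<And>t. 0 \<le> f t"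
  shows "(f \<longlongrightarrow> Inf (f ` {0..})) at_top"
proof (rule decreasing_tendsto)
  have "bdd_below (f ` {0..})"
    using bdd by (intro bdd_belowI2[of _ 0]) auto
  then show "\<forall>\<^sub>F t in at_top. Inf (f ` {0..}) \<le> f t"
    unfolding eventually_at_top_linorder by (intro exI[of _ 0] allI impI cInf_lower) auto
  fix x
  assume "Inf (f ` {0..}) < x"
  then have "\<exists>y\<in>f ` {0..}. y < x"
    using cInf_less_iff[of "f ` {0..}" x] \<open>bdd_below (f ` {0..})\<close> by blast
  then obtain T where T: "0 \<le> T" "f T < x"
    by auto
  show "\<forall>\<^sub>F t in at_top. f t < x"
    unfolding eventually_at_top_linorder
  proof (intro exI[of _ T] allI impI)
    fix t
    assume "T \<le> t"
    then show "f t < x"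
      using mono[OF T(1) \<open>T \<le> t\<close>] T(2) by linarith
  qed
qed

context damped_skew_system
begin

lemma energy_drop_on_interval:
  assumes decay: "\<And>a L. 0 \<le> a \<Longrightarrow> 0 < L \<Longrightarrow> L \<le> L0 \<Longrightarrow> \<rho> * L \<le> integral {a..a + L} damping \<Longrightarrow>
                    c * L^(2 * K + 1) * energy a \<le> energy a - energy (a + L)"
    and c: "0 < c" and L0: "0 < L0"
    and v: "\<And>t. 0 \<le> t \<Longrightarrow> v \<le> energy t" "0 \<le> v"
    and ab: "0 \<le> a" "a \<le> b" and mass: "\<rho> * (b - a) \<le> integral {a..b} damping"
  shows "c * (min (b - a) (L0 / 2))^(2 * K + 1) * v \<le> energy a - energy b"
proof (cases "a = b")
  case True
  then show ?thesis
    using L0 by simp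
next
  case False
  obtain a' h where sub: "a \<le> a'" "a' + h \<le> b" "min (b - a) (L0 / 2) \<le> h" "0 < h" "h \<le> L0"
    and mass': "\<rho> * h \<le> integral {a'..a' + h} damping"
  proof (cases "b - a \<le> L0")
    case True
    then show ?thesis
      using that[of a "b - a"] False ab mass by simp
  next
    case False
    then have "L0 < b - a"
      by simp
    then obtain a' h where "a \<le> a'" "a' + h \<le> b" "L0 / 2 \<le> h" "h \<le> L0"
      "\<rho> * h \<le> integral {a'..a' + h} damping"
      using exists_subinterval_with_mass[OF integrable_damping L0] mass by blast
    then show ?thesis
      using that[of a' h] L0 by force
  qed
  have "0 \<le> min (b - a) (L0 / 2)"
    using ab L0 by simp
  then have "c * (min (b - a) (L0 / 2))^(2 * K + 1) * v \<le> c * h^(2 * K + 1) * energy a'"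
    using c v sub ab by (intro mult_mono mult_left_mono power_mono) auto
  also have "\<dots> \<le> energy a' - energy (a' + h)"
    using decay[OF _ sub(4,5) mass'] sub ab by simp
  also have "\<dots> \<le> energy a - energy b"
    using energy_antimono[OF ab(1) sub(1)] energy_antimono[of "a' + h" b] sub ab by simp
  finally show ?thesis .
qed

lemma summable_energy_drops:
  assumes decay: "\<And>a L. 0 \<le> a \<Longrightarrow> 0 < L \<Longrightarrow> L \<le> L0 \<Longrightarrow> \<rho> * L \<le> integral {a..a + L} damping \<Longrightarrow>
                    c * L^(2 * K + 1) * energy a \<le> energy a - energy (a + L)"
    and c: "0 < c" and L0: "0 < L0"
    and v: "\<And>t. 0 \<le> t \<Longrightarrow> v \<le> energy t" "0 < v"
    and intervals: "\<And>n. 0 \<le> a n \<and> a n \<le> b n"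
    and disjoint: "\<And>m n. m \<noteq> n \<Longrightarrow> {a m<..<b m} \<inter> {a n<..<b n} = {}"
    and mass: "\<And>n. \<rho> * (b n - a n) \<le> integral {a n..b n} damping"
  shows "summable (\<lambda>n. (min (b n - a n) (L0 / 2))^(2 * K + 1))"
proof (rule summableI_nonneg_bounded[where x = "energy 0 / (c * v)"])
  define \<theta> where "\<theta> n = (min (b n - a n) (L0 / 2))^(2 * K + 1)" for n
  show "0 \<le> \<theta> n" for n
    using intervals[of n] L0 by (simp add: \<theta>_def)
  fix N
  define S where "S = {n\<in>{..<N}. a n < b n}"
  have "c * v * (\<Sum>n<N. \<theta> n) \<le> (\<Sum>n<N. energy (a n) - energy (b n))"
    unfolding sum_distrib_left using intervals mass v
    by (intro sum_mono) (auto simp: \<theta>_def mult_ac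
        intro: order.trans[OF _ energy_drop_on_interval[OF decay c L0]])
  also have "\<dots> = (\<Sum>n\<in>S. energy (a n) - energy (b n))"
    using intervals by (intro sum.mono_neutral_right) (auto simp: S_def less_le)
  also have "\<dots> \<le> energy 0 - energy (Max (insert 0 (b ` S)))"
  proof (rule sum_drops_le_of_disjoint_intervals[where F = energy and c = 0])
    show "0 \<le> a n \<and> a n < b n \<and> b n \<le> Max (insert 0 (b ` S))" if "n \<in> S" for n
      using that intervals[of n] by (auto simp: S_def)
    show "b m \<le> a n \<or> b n \<le> a m" if "m \<in> S" "n \<in> S" "m \<noteq> n" for m n
      using that disjoint[of m n] by (intro disjoint_greaterThanLessThan_imp_le) (auto simp: S_def)
  qed (auto simp: S_def intro: energy_antimono)
  also have "\<dots> \<le> energy 0"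
    by (simp add: energy_def)
  finally show "(\<Sum>n<N. \<theta> n) \<le> energy 0 / (c * v)"
    using c v by (simp add: field_simps mult_ac)
qed

lemma interval_lebesgue_integral_alpha_eq:
  assumes "0 \<le> u" "u \<le> v"
  shows "(LBINT t=u..v. \<alpha> t) = integral {u..v} damping"
proof -
  have "set_integrable lborel {u..v} \<alpha>"
    using set_integrable_damping[of u v] unfolding set_integrable_def
    by (rule Bochner_Integration.integrable_cong[THEN iffD1, rotated -1])
      (use assms in \<open>auto simp: indicator_def damping_eq\<close>)
  then have "(LBINT t=u..v. \<alpha> t) = integral {u..v} \<alpha>"
    by (rule interval_integral_eq_integral[OF assms(2)])
  also have "\<dots> = integral {u..v} damping"
    using assms by (intro integral_cong) (auto simp: damping_eq)
  finally show ?thesis .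
qed

end

theorem corollary5p1:
  fixes A :: "real^'n^'n" and B :: "real^'r^'n" and \<rho> :: real
    and \<alpha> :: "real \<Rightarrow> real" and a b :: "nat \<Rightarrow> real" and z :: "real \<Rightarrow> real^'n"
  assumes skew: "transpose A = - A"
    and ctrl: "controllable A B"
    and rho_pos: "\<rho> > 0"
    and alpha_meas: "\<alpha> \<in> borel_measurable (restrict_space lborel {0..})"
    and alpha_range: "\<And>t. t \<ge> 0 \<Longrightarrow> 0 \<le> \<alpha> t \<and> \<alpha> t \<le> 1"
    and intervals: "\<And>n. 0 \<le> a n \<and> a n \<le> b n"
    and disjoint: "\<And>m n. m \<noteq> n \<Longrightarrow> {a m<..<b m} \<inter> {a n<..<b n} = {}"
    and mass: "\<And>n. (LBINT t=a n..b n. \<alpha> t) \<ge> \<rho> * (b n - a n)"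
    and diverge: "\<not> summable (\<lambda>n. (b n - a n) ^ (2 * kalman_index A B + 1))"
    and sol: "is_solution A B \<alpha> z"
  shows "((\<lambda>t. norm (z t)) \<longlongrightarrow> 0) at_top"
proof -
  interpret damped_skew_system A B \<alpha> z
    using skew alpha_meas alpha_range sol by unfold_locales
  obtain c L0 where c: "0 < c" "0 < L0" and decay: "\<And>a L. 0 \<le> a \<Longrightarrow> 0 < L \<Longrightarrow> L \<le> L0 \<Longrightarrow>
      \<rho> * L \<le> integral {a..a + L} damping \<Longrightarrow>
      c * L^(2 * kalman_index A B + 1) * energy a \<le> energy a - energy (a + L)"
    using local_energy_decay[OF ctrl rho_pos] by metis
  define v where "v = Inf (energy ` {0..})"
  have "(energy \<longlongrightarrow> v) at_top"
    unfolding v_def using energy_antimono by (intro antimono_tendsto_Inf) (auto simp: energy_def)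
  moreover have "v = 0"
  proof (rule ccontr)
    assume "v \<noteq> 0"
    have "v \<le> energy t" if "0 \<le> t" for t
      unfolding v_def using that by (intro cInf_lower bdd_belowI2[of _ 0]) (auto simp: energy_def)
    moreover have "0 \<le> v"
      unfolding v_def by (intro cInf_greatest) (auto simp: energy_def)
    ultimately have "summable (\<lambda>n. (min (b n - a n) (L0 / 2))^(2 * kalman_index A B + 1))"
      using \<open>v \<noteq> 0\<close> mass intervals interval_lebesgue_integral_alpha_eq
      by (intro summable_energy_drops[OF decay c _ _ intervals disjoint]) auto
    then have "summable (\<lambda>n. (b n - a n)^(2 * kalman_index A B + 1))"
      by (rule summable_of_summable_min_pow) (use c in auto)
    then show False
      using diverge by contradiction
  qed
  ultimately have "((\<lambda>t. sqrt (energy t)) \<longlongrightarrow> sqrt 0) at_top"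
    by (intro tendsto_real_sqrt) simp
  then show ?thesis
    by (simp add: energy_def)
qed

end
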